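(* Let $w$, $\boldsymbol F: X\to X$, $X_0$, $\boldsymbol z^{(1)},\dots,\boldsymbol z^{(p)}$, $\boldsymbol\omega$, $\mu$, $\tilde{\boldsymbol h}$ satisfy hypotheses H1, H2 and H3 of the context (torus dimension $d$, smoothness $M$, island period $p\ge 1$, Diophantine exponent $\nu$). Let $m$ and $C_m$ be identical to those of the weighted Birkhoff average theorem recalled in the context; that is, $m>1$ is an integer with $M>d+m\nu$, and $C_m$ is the constant of that theorem, for which $$\Big|\mathcal{WB}_{N}[\tilde{\boldsymbol h}](\boldsymbol x)-\int_{X_0}\tilde{\boldsymbol h}\,d\mu\Big|\le C_m N^{-m}$$ with $C_m$ independent of $\boldsymbol x\in X_0$. Then the residual $R^2$ of the Birkhoff RRE least-squares problem defined in the context (with initial point $\boldsymbol x_0\in X_0$, parameters $K,T$ and regularization $\epsilon\ge0$) converges, independently of how $T$ depends on $K$, as $$\epsilon \;\le\; R^2 \;\le\; \epsilon + C_m\,(2K)^{-2m},$$ with this same $m$ and this same constant $C_m$.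
   Context: Notation: $\mathbb T=\mathbb R/\mathbb Z$; $R_\omega:\mathbb T^d\to\mathbb T^d$, $R_\omega(\boldsymbol\theta)=\boldsymbol\theta+\boldsymbol\omega$; $M$ is a positive integer or $\infty$. Hypotheses. H1 (smooth bump function): $w\in C^\infty(\mathbb R)$ has compact support on $[0,1]$ and $w(x)>0$ for all $x\in(0,1)$. H2 (Diophantine): $\boldsymbol\omega$ is a rotation vector satisfying a $(c,\nu)$ Diophantine condition: $|\boldsymbol\omega\cdot\boldsymbol n-\ell|\ge c\,\|\boldsymbol n\|^{-\nu}$ for all $\boldsymbol n\in\mathbb Z^d\setminus\{0\}$ and $\ell\in\mathbb Z$. H3 (smooth system): $X$ is a $C^M$ manifold and $\boldsymbol F:X\to X$ is $C^M$. $X_0\subseteq X$ is a set on which $\boldsymbol F$ is conjugate to island dynamics with rotation vector $\boldsymbol\omega$, invariant measure $\mu$ and period $p\ge1$: there are maps $\boldsymbol z^{(j)}:\mathbb T^d\to X$ in $C^M$, $1\le j\le p$, whose images make up $X_0$, with $\boldsymbol F\circ\boldsymbol z^{(j)}=\boldsymbol z^{(j+1)}$ for $1\le j<p$ and $\boldsymbol F\circ \boldsymbol z^{(p)}=\boldsymbol z^{(1)}\circ R_\omega$. The observable $\tilde{\boldsymbol h}:X\to\mathbb R^D$ is $C^M$. (The case $p=1$ is an invariant torus.) Weights and weighted Birkhoff average. For a positive integer $N$ and $0\le k\le N-1$, $$w_{k,N}=\Big(\sum_{j=0}^{N-1}w\big(\tfrac{j+1}{N+1}\big)\Big)^{-1}w\big(\tfrac{k+1}{N+1}\big),\qquad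 \mathcal{WB}_N[\tilde{\boldsymbol h}](\boldsymbol x)=\sum_{k=0}^{N-1}w_{k,N}\,\tilde{\boldsymbol h}(\boldsymbol F^k(\boldsymbol x)).$$ Weighted Birkhoff average theorem (Das and Yorke, extended to islands). Let $m>1$ be an integer. Under H1, H2, H3, there is a constant $C_m$ depending on $w,\tilde{\boldsymbol h},m,M,\nu,p$ but independent of $\boldsymbol x\in X_0$ such that $\big|\mathcal{WB}_N[\tilde{\boldsymbol h}](\boldsymbol x)-\int_{X_0}\tilde{\boldsymbol h}\,d\mu\big|\le C_mN^{-m}$, provided $M>d+m\nu$. The Birkhoff RRE least-squares problem. Given $\boldsymbol x_0\in X_0$, positive integers $K,T$ and $\epsilon\ge0$, put $\boldsymbol a_t=\tilde{\boldsymbol h}(\boldsymbol F^t(\boldsymbol x_0))$ and $\boldsymbol u_t=\boldsymbol a_{t+1}-\boldsymbol a_t\in\mathbb R^D$ for $0\le t\le T-1+2K$. Let $U\in\mathbb R^{TD\times(2K+1)}$ be the block Hankel matrix whose $(t,k)$ block is $\boldsymbol u_{t+k}$ ($0\le t\le T-1$, $0\le k\le 2K$). Let $W_T\in\mathbb R^{TD\times TD}$ be block diagonal with blocks $w_{t,T}I_D$, $0\le t\le T-1$. Let $W_K\in\mathbb R^{(2K+1)\times(2K+1)}$ be diagonal with entries $(W_K)_{kk}=\tfrac12\,(w_{k,2K+1}+w_{2K-k,2K+1})$, $0\le k\le 2K$. Then $$R^2=\min_{\boldsymbol c}\ \left\|\begin{pmatrix}W_T^{1/2}U\\ \epsilon^{1/2}W_K^{-1/2}\end{pmatrix}\boldsymbol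 c\right\|^2,$$ the minimum being over $\boldsymbol c=(c_0,\dots,c_{2K})\in\mathbb R^{2K+1}$ with $\sum_{k=0}^{2K}c_k=1$ and $c_{K+k}-c_{K-k}=0$ for $1\le k\le K$.
   Formalization: "This same constant C_m" is read as: there is one constant C_m, independent of x, N, x_0, K, T and ε, for which both the weighted Birkhoff bound and the residual bound hold; for an arbitrary or least C_m of the Birkhoff bound the claim fails, since rescaling h scales R² quadratically. *)

theory Defs
  imports "HOL-Analysis.Analysis"
begin

section \<open>Functions, manifolds and maps of class \<open>C\<^sup>k\<close>\<close>

text \<open>Used for open \<open>S\<close> only. The successor case asks that all directional
  derivatives are of class \<open>C\<^sup>n\<close>; on a finite-dimensional space this is the
  same as asking it of the derivative as an operator-valued map.\<close>

primrec Cn_on :: "nat \<Rightarrow> 'a::euclidean_space set \<Rightarrow> ('a \<Rightarrow> 'b::real_normed_vector) \<Rightarrow> bool" where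
  "Cn_on 0 S f \<longleftrightarrow> continuous_on S f"
| "Cn_on (Suc n) S f \<longleftrightarrow> (\<forall>x\<in>S. f differentiable (at x)) \<and>
     (\<forall>v. Cn_on n S (\<lambda>x. frechet_derivative f (at x) v))"

definition Ck_on :: "enat \<Rightarrow> 'a::euclidean_space set \<Rightarrow> ('a \<Rightarrow> 'b::real_normed_vector) \<Rightarrow> bool" where
  "Ck_on k S f \<longleftrightarrow> (\<forall>n. enat n \<le> k \<longrightarrow> Cn_on n S f)"

type_synonym ('x, 'e) chart = "'x set \<times> ('x \<Rightarrow> 'e)"

definition is_chart :: "'x topology \<Rightarrow> ('x, 'e::euclidean_space) chart \<Rightarrow> bool" where
  "is_chart X = (\<lambda>(U, \<phi>). openin X U \<and> open (\<phi> ` U) \<and>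
     homeomorphic_map (subtopology X U) (top_of_set (\<phi> ` U)) \<phi>)"

definition Ck_manifold :: "enat \<Rightarrow> 'x topology \<Rightarrow> ('x, 'e::euclidean_space) chart set \<Rightarrow> bool" where
  "Ck_manifold k X A \<longleftrightarrow>
     Hausdorff_space X \<and> second_countable X \<and>
     (\<forall>a\<in>A. is_chart X a) \<and>
     (\<Union>(U, \<phi>)\<in>A. U) = topspace X \<and>
     (\<forall>(U, \<phi>)\<in>A. \<forall>(V, \<psi>)\<in>A. Ck_on k (\<phi> ` (U \<inter> V)) (\<psi> \<circ> inv_into U \<phi>))"

definition Ck_map :: "enat \<Rightarrow> 'x topology \<Rightarrow> ('x, 'e::euclidean_space) chart set \<Rightarrow>
    'y topology \<Rightarrow> ('y, 'f::euclidean_space) chart set \<Rightarrow> ('x \<Rightarrow> 'y) \<Rightarrow> bool" where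
  "Ck_map k X A Y B f \<longleftrightarrow>
     continuous_map X Y f \<and>
     (\<forall>(U, \<phi>)\<in>A. \<forall>(V, \<psi>)\<in>B. Ck_on k (\<phi> ` (U \<inter> f -` V)) (\<psi> \<circ> f \<circ> inv_into U \<phi>))"

definition std_atlas :: "('e, 'e::euclidean_space) chart set" where
  "std_atlas = {(UNIV, \<lambda>x. x)}"

section \<open>Hypotheses\<close>

definition smooth_bump :: "(real \<Rightarrow> real) \<Rightarrow> bool" where
  "smooth_bump w \<longleftrightarrow> Ck_on \<infinity> UNIV w \<and> (\<forall>x. x \<notin> {0..1} \<longrightarrow> w x = 0) \<and> (\<forall>x\<in>{0<..<1}. 0 < w x)"

definition int_vec :: "int ^ 'd \<Rightarrow> real ^ 'd" where
  "int_vec n = (\<chi> i. of_int (n $ i))"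

definition diophantine :: "real \<Rightarrow> real \<Rightarrow> real ^ 'd \<Rightarrow> bool" where
  "diophantine c \<nu> \<omega> \<longleftrightarrow> 0 < c \<and>
     (\<forall>n l. n \<noteq> 0 \<longrightarrow> \<bar>\<omega> \<bullet> int_vec n - of_int l\<bar> \<ge> c * norm (int_vec n) powr (- \<nu>))"

definition borel_of :: "'x topology \<Rightarrow> 'x measure" where
  "borel_of X = sigma (topspace X) {U. openin X U}"

definition invariant_prob :: "'x topology \<Rightarrow> ('x \<Rightarrow> 'x) \<Rightarrow> 'x set \<Rightarrow> 'x measure \<Rightarrow> bool" where
  "invariant_prob X F X\<^sub>0 \<mu> \<longleftrightarrow>
     sets \<mu> = sets (borel_of X) \<and> emeasure \<mu> (space \<mu>) = 1 \<and> emeasure \<mu> X\<^sub>0 = 1 \<and> distr \<mu> \<mu> F = \<mu>"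

text \<open>A map on the torus \<open>\<real>\<^sup>d/\<int>\<^sup>d\<close> is given by its lift, a \<open>\<int>\<^sup>d\<close>-periodic map on
  \<open>\<real>\<^sup>d\<close>; the quotient map is a local diffeomorphism, so the lift has the same smoothness,
  and the rotation by \<open>\<omega>\<close> lifts to the translation by \<open>\<omega>\<close>.\<close>

definition torus_Ck_map :: "enat \<Rightarrow> 'x topology \<Rightarrow> ('x, 'e::euclidean_space) chart set \<Rightarrow>
    (real ^ 'd \<Rightarrow> 'x) \<Rightarrow> bool" where
  "torus_Ck_map k X A z \<longleftrightarrow>
     Ck_map k euclidean std_atlas X A z \<and> (\<forall>\<theta> n. z (\<theta> + int_vec n) = z \<theta>)"

definition island_dynamics :: "enat \<Rightarrow> 'x topology \<Rightarrow> ('x, 'e::euclidean_space) chart set \<Rightarrow>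
    ('x \<Rightarrow> 'x) \<Rightarrow> 'x set \<Rightarrow> real ^ 'd \<Rightarrow> 'x measure \<Rightarrow> nat \<Rightarrow> (nat \<Rightarrow> real ^ 'd \<Rightarrow> 'x) \<Rightarrow> bool" where
  "island_dynamics k X A F X\<^sub>0 \<omega> \<mu> p z \<longleftrightarrow>
     1 \<le> p \<and>
     (\<forall>j\<in>{1..p}. torus_Ck_map k X A (z j)) \<and>
     X\<^sub>0 = (\<Union>j\<in>{1..p}. range (z j)) \<and>
     (\<forall>j\<in>{1..<p}. \<forall>\<theta>. F (z j \<theta>) = z (j + 1) \<theta>) \<and>
     (\<forall>\<theta>. F (z p \<theta>) = z 1 (\<theta> + \<omega>)) \<and>
     invariant_prob X F X\<^sub>0 \<mu>"

section \<open>Weighted Birkhoff averages\<close>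

definition bump_weight :: "(real \<Rightarrow> real) \<Rightarrow> nat \<Rightarrow> nat \<Rightarrow> real" where
  "bump_weight w N k =
     inverse (\<Sum>j<N. w (real (j + 1) / real (N + 1))) * w (real (k + 1) / real (N + 1))"

definition WB :: "(real \<Rightarrow> real) \<Rightarrow> ('x \<Rightarrow> 'x) \<Rightarrow> nat \<Rightarrow> ('x \<Rightarrow> 'v::real_vector) \<Rightarrow> 'x \<Rightarrow> 'v" where
  "WB w F N h x = (\<Sum>k<N. bump_weight w N k *\<^sub>R h ((F ^^ k) x))"

section \<open>The Birkhoff RRE least-squares problem\<close>

text \<open>A matrix is a function of a row and a column index, restricted to finite index sets.
  The \<open>TD\<close> rows of \<open>U\<close> are indexed by pairs \<open>(t, i)\<close>, where \<open>i\<close> is a component of \<open>\<real>\<^sup>D\<close>,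
  and the rows of the stacked matrix by the disjoint sum of the row indices of its two parts.\<close>

type_synonym ('r, 'c) rmat = "'r \<Rightarrow> 'c \<Rightarrow> real"

definition rmat_mult :: "'k set \<Rightarrow> ('r, 'k) rmat \<Rightarrow> ('k, 'c) rmat \<Rightarrow> ('r, 'c) rmat" where
  "rmat_mult J A B = (\<lambda>i k. \<Sum>j\<in>J. A i j * B j k)"

text \<open>Real powers of a diagonal matrix with nonnegative entries.\<close>

definition diag_powr :: "('r, 'r) rmat \<Rightarrow> real \<Rightarrow> ('r, 'r) rmat" where
  "diag_powr A s = (\<lambda>i j. if i = j then A i i powr s else 0)"

definition rre_diff :: "('x \<Rightarrow> 'x) \<Rightarrow> ('x \<Rightarrow> real ^ 'D) \<Rightarrow> 'x \<Rightarrow> nat \<Rightarrow> real ^ 'D" where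
  "rre_diff F h x\<^sub>0 t = h ((F ^^ (t + 1)) x\<^sub>0) - h ((F ^^ t) x\<^sub>0)"

definition rre_U :: "('x \<Rightarrow> 'x) \<Rightarrow> ('x \<Rightarrow> real ^ 'D) \<Rightarrow> 'x \<Rightarrow> (nat \<times> 'D, nat) rmat" where
  "rre_U F h x\<^sub>0 = (\<lambda>(t, i) k. rre_diff F h x\<^sub>0 (t + k) $ i)"

definition rre_WT :: "(real \<Rightarrow> real) \<Rightarrow> nat \<Rightarrow> (nat \<times> 'D, nat \<times> 'D) rmat" where
  "rre_WT w T = (\<lambda>(t, i) (s, j). if (t, i) = (s, j) then bump_weight w T t else 0)"

definition rre_WK :: "(real \<Rightarrow> real) \<Rightarrow> nat \<Rightarrow> (nat, nat) rmat" where
  "rre_WK w K = (\<lambda>k l. if k = l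
     then (bump_weight w (2 * K + 1) k + bump_weight w (2 * K + 1) (2 * K - k)) / 2 else 0)"

definition rre_matrix :: "(real \<Rightarrow> real) \<Rightarrow> ('x \<Rightarrow> 'x) \<Rightarrow> ('x \<Rightarrow> real ^ 'D) \<Rightarrow> 'x \<Rightarrow>
    nat \<Rightarrow> nat \<Rightarrow> real \<Rightarrow> ((nat \<times> 'D) + nat, nat) rmat" where
  "rre_matrix w F h x\<^sub>0 K T \<epsilon> = case_sum
     (rmat_mult ({..<T} \<times> UNIV) (diag_powr (rre_WT w T) (1/2)) (rre_U F h x\<^sub>0))
     (\<lambda>k l. \<epsilon> powr (1/2) * diag_powr (rre_WK w K) (-1/2) k l)"

definition rre_objective :: "(real \<Rightarrow> real) \<Rightarrow> ('x \<Rightarrow> 'x) \<Rightarrow> ('x \<Rightarrow> real ^ 'D) \<Rightarrow> 'x \<Rightarrow>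
    nat \<Rightarrow> nat \<Rightarrow> real \<Rightarrow> (nat \<Rightarrow> real) \<Rightarrow> real" where
  "rre_objective w F h x\<^sub>0 K T \<epsilon> c =
     (\<Sum>r\<in>({..<T} \<times> UNIV) <+> {..2 * K}. (\<Sum>k\<le>2 * K. rre_matrix w F h x\<^sub>0 K T \<epsilon> r k * c k)\<^sup>2)"

definition rre_feasible :: "nat \<Rightarrow> (nat \<Rightarrow> real) set" where
  "rre_feasible K = {c. (\<Sum>k\<le>2 * K. c k) = 1 \<and> (\<forall>k\<in>{1..K}. c (K + k) - c (K - k) = 0)}"

definition rre_residual_sq :: "(real \<Rightarrow> real) \<Rightarrow> ('x \<Rightarrow> 'x) \<Rightarrow> ('x \<Rightarrow> real ^ 'D) \<Rightarrow> 'x \<Rightarrow>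
    nat \<Rightarrow> nat \<Rightarrow> real \<Rightarrow> real" where
  "rre_residual_sq w F h x\<^sub>0 K T \<epsilon> = (LEAST r. r \<in> rre_objective w F h x\<^sub>0 K T \<epsilon> ` rre_feasible K)"

end

theory Submission
  imports Defs "HOL-Probability.Probability_Measure"
begin

text \<open>
  Composed with the island maps, the observable becomes finitely many \<open>C\<^sup>k\<close> functions on the torus.
  Their Fourier coefficients decay like \<open>\<parallel>n\<parallel>\<^sup>-\<^sup>k\<close>, while a bump-weighted exponential sum of frequency
  \<open>\<alpha>\<close> is \<open>O((N dist(\<alpha>, \<int>))\<^sup>-\<^sup>m)\<close> by \<open>m\<close> summations by parts. Along an island orbit the \<open>n\<close>-th mode has the
  frequencies \<open>(\<omega> \<bullet> n + r) / p\<close>, \<open>r < p\<close>, so the Diophantine condition and \<open>k > d + m \<nu>\<close> give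
  convergence of the weighted averages at rate \<open>N\<^sup>-\<^sup>m\<close> to a constant. Since
  \<open>\<mu>\<close> is invariant, the averages have the same integral as the observable, which identifies this constant.

  For the least-squares problem the test vector \<open>c\<^sub>k = (W\<^sub>K)\<^sub>k\<^sub>k\<close> consists of the weights of the symmetrized
  bump function \<open>(w(x) + w(1 - x)) / 2\<close>. Its penalty is exactly \<open>\<epsilon>\<close>, and \<open>U c\<close> is a difference of two weighted
  averages, each close to the same integral. That the penalty is never below \<open>\<epsilon>\<close> is the Cauchy-Schwarz
  inequality. The constant \<open>C\<^sub>m\<close> is the maximum of those for the two parts.

  Fourier coefficients are obtained as limits of discrete Fourier coefficients on grids, for which inversion and
  decay are statements about finite sums.
\<close>

section \<open>Directional derivatives and functions of class \<open>C\<^sup>n\<close>\<close>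

definition dir_deriv :: "'a \<Rightarrow> ('a::real_normed_vector \<Rightarrow> 'b::real_normed_vector) \<Rightarrow> 'a \<Rightarrow> 'b" where
  "dir_deriv v f x = frechet_derivative f (at x) v"

lemma has_derivative_dir_deriv:
  "f differentiable at x \<Longrightarrow> (f has_derivative (\<lambda>v. dir_deriv v f x)) (at x)"
  using frechet_derivative_works unfolding dir_deriv_def by metis

lemma dir_deriv_eqI: "(f has_derivative f') (at x) \<Longrightarrow> dir_deriv v f x = f' v"
  using frechet_derivative_at unfolding dir_deriv_def by metis

lemma linear_dir_deriv: "f differentiable at x \<Longrightarrow> linear (\<lambda>v. dir_deriv v f x)"
  by (rule has_derivative_linear[OF has_derivative_dir_deriv])

lemma dir_deriv_eq_0_on_open:
  assumes "open S" "\<And>x. x \<in> S \<Longrightarrow> f x = 0" "x \<in> S"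
  shows "dir_deriv v f x = 0"
proof -
  have "(f has_derivative (\<lambda>_. 0)) (at x)"
    by (rule has_derivative_transform_within_open[OF has_derivative_const assms(1,3)])
      (simp add: assms(2))
  then show ?thesis by (rule dir_deriv_eqI)
qed

lemma Cn_on_Suc_iff:
  "Cn_on (Suc n) S f \<longleftrightarrow> (\<forall>x\<in>S. f differentiable at x) \<and> (\<forall>v. Cn_on n S (dir_deriv v f))"
  by (simp add: dir_deriv_def[abs_def])

lemma Cn_on_SucD:
  assumes "Cn_on (Suc n) S f"
  shows "x \<in> S \<Longrightarrow> f differentiable at x"
    and "x \<in> S \<Longrightarrow> (f has_derivative (\<lambda>v. dir_deriv v f x)) (at x)"
    and "Cn_on n S (dir_deriv v f)"
  using assms has_derivative_dir_deriv[of f x] unfolding Cn_on_Suc_iff by blast+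

lemma Cn_on_Suc_imp: "Cn_on (Suc n) S f \<Longrightarrow> Cn_on n S f"
proof (induction n arbitrary: f)
  case 0
  then show ?case
    by (auto intro!: continuous_at_imp_continuous_on differentiable_imp_continuous_within)
next
  case (Suc n)
  then show ?case by (metis Cn_on_Suc_iff)
qed

lemma Cn_on_imp_continuous_on: "Cn_on n S f \<Longrightarrow> continuous_on S f"
  by (induction n) (auto dest: Cn_on_Suc_imp simp del: Cn_on.simps(2))

lemma continuous_on_funpow_dir_deriv: "Cn_on n S f \<Longrightarrow> continuous_on S ((dir_deriv v ^^ n) f)"
  by (induction n arbitrary: f)
    (simp_all add: funpow_Suc_right Cn_on_Suc_iff del: Cn_on.simps(2) funpow.simps(2))

lemma Cn_on_cong:
  assumes "open S" "\<And>x. x \<in> S \<Longrightarrow> f x = g x" "Cn_on n S f"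
  shows "Cn_on n S g"
  using assms(2,3)
proof (induction n arbitrary: f g)
  case 0
  then show ?case by (simp cong: continuous_on_cong)
next
  case (Suc n)
  have deriv_g: "(g has_derivative (\<lambda>v. dir_deriv v f x)) (at x)" if "x \<in> S" for x
    using has_derivative_transform_within_open[OF Cn_on_SucD(2)[OF Suc.prems(2)]]
      assms(1) Suc.prems(1) that
    by blast
  have "Cn_on n S (dir_deriv v g)" for v
    by (rule Suc.IH[OF _ Cn_on_SucD(3)[OF Suc.prems(2)]]) (rule dir_deriv_eqI[OF deriv_g, symmetric])
  with deriv_g show ?case unfolding Cn_on_Suc_iff differentiable_def by blast
qed

lemma Cn_on_SucI:
  assumes "open S" "\<And>x. x \<in> S \<Longrightarrow> (f has_derivative f' x) (at x)"
    and "\<And>v. Cn_on n S (\<lambda>x. f' x v)"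
  shows "Cn_on (Suc n) S f"
proof -
  have "Cn_on n S (dir_deriv v f)" for v
    by (rule Cn_on_cong[OF assms(1) _ assms(3)]) (rule dir_deriv_eqI[OF assms(2), symmetric])
  with assms(2) show ?thesis unfolding Cn_on_Suc_iff differentiable_def by blast
qed

lemma Cn_on_local:
  assumes "\<And>x. x \<in> S \<Longrightarrow> \<exists>T. open T \<and> x \<in> T \<and> Cn_on n T f"
  shows "Cn_on n S f"
  using assms
proof (induction n arbitrary: f)
  case 0
  then show ?case
    by (force intro!: continuous_at_imp_continuous_on simp: continuous_on_eq_continuous_at)
next
  case (Suc n)
  then show ?case unfolding Cn_on_Suc_iff by metis
qed

lemma Cn_on_const: "Cn_on n S (\<lambda>x. c)"
  by (induction n arbitrary: c) auto

lemma Cn_on_bounded_linear: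
  assumes "open S" "bounded_linear L" "Cn_on n S f"
  shows "Cn_on n S (\<lambda>x. L (f x))"
  using assms(3)
proof (induction n arbitrary: f)
  case 0
  then show ?case using assms(2) by (simp add: bounded_linear.continuous_on)
next
  case (Suc n)
  show ?case
    by (rule Cn_on_SucI[OF assms(1) bounded_linear.has_derivative[OF assms(2) Cn_on_SucD(2)[OF Suc.prems]]])
      (use Suc.IH Cn_on_SucD(3)[OF Suc.prems] in auto)
qed

lemma Cn_on_add:
  assumes "open S" "Cn_on n S f" "Cn_on n S g"
  shows "Cn_on n S (\<lambda>x. f x + g x)"
  using assms(2,3)
proof (induction n arbitrary: f g)
  case 0
  then show ?case by (simp add: continuous_on_add)
next
  case (Suc n)
  show ?case
    by (rule Cn_on_SucI[OF assms(1) has_derivative_add[OF Suc.prems[THEN Cn_on_SucD(2)]]])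
      (use Suc.IH Suc.prems[THEN Cn_on_SucD(3)] in auto)
qed

lemma Cn_on_sum:
  assumes "open S" "\<And>i. i \<in> I \<Longrightarrow> Cn_on n S (f i)"
  shows "Cn_on n S (\<lambda>x. \<Sum>i\<in>I. f i x)"
  using assms(2)
  by (induction I rule: infinite_finite_induct) (auto intro: Cn_on_const Cn_on_add[OF assms(1)])

lemma Cn_on_scaleR:
  assumes "open S" "Cn_on n S a" "Cn_on n S f"
  shows "Cn_on n S (\<lambda>x. a x *\<^sub>R f x)"
  using assms(2,3)
proof (induction n arbitrary: a f)
  case 0
  then show ?case by (simp add: continuous_on_scaleR)
next
  case (Suc n)
  show ?case
    by (rule Cn_on_SucI[OF assms(1) has_derivative_scaleR[OF Suc.prems[THEN Cn_on_SucD(2)]]])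
      (use Suc.IH Suc.prems[THEN Cn_on_SucD(3)] Suc.prems[THEN Cn_on_Suc_imp]
       in \<open>auto intro!: Cn_on_add[OF assms(1)]\<close>)
qed

lemma has_derivative_compose_Basis:
  fixes g :: "'a::real_normed_vector \<Rightarrow> 'b::euclidean_space"
  assumes g_diff: "g differentiable at x" and f_diff: "f differentiable at (g x)"
  shows "((\<lambda>x. f (g x)) has_derivative
    (\<lambda>v. \<Sum>b\<in>Basis. (dir_deriv v g x \<bullet> b) *\<^sub>R dir_deriv b f (g x))) (at x)"
proof -
  have "dir_deriv y f (g x) = (\<Sum>b\<in>Basis. (y \<bullet> b) *\<^sub>R dir_deriv b f (g x))" for y
    by (subst euclidean_representation[of y, symmetric])
      (simp only: linear_sum[OF linear_dir_deriv[OF f_diff]] linear_cmul[OF linear_dir_deriv[OF f_diff]])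
  then have "(\<lambda>v. dir_deriv (dir_deriv v g x) f (g x)) =
      (\<lambda>v. \<Sum>b\<in>Basis. (dir_deriv v g x \<bullet> b) *\<^sub>R dir_deriv b f (g x))"
    by (rule ext)
  with has_derivative_compose[OF has_derivative_dir_deriv[OF g_diff] has_derivative_dir_deriv[OF f_diff]]
  show ?thesis by (rule has_derivative_eq_rhs)
qed

lemma Cn_on_compose:
  fixes g :: "'a::euclidean_space \<Rightarrow> 'b::euclidean_space"
  assumes "open S" "g ` S \<subseteq> T" "Cn_on n T f" "Cn_on n S g"
  shows "Cn_on n S (\<lambda>x. f (g x))"
  using assms(3,4)
proof (induction n arbitrary: f)
  case 0
  then show ?case using assms(2) by (auto intro: continuous_on_compose2)
next
  case (Suc n)
  show ?case
  proof (rule Cn_on_SucI[OF assms(1) has_derivative_compose_Basis])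
    fix x assume "x \<in> S"
    then show "g differentiable at x" "f differentiable at (g x)"
      using Suc.prems assms(2) by (auto intro: Cn_on_SucD(1))
  next
    fix v
    have "Cn_on n S (\<lambda>x. dir_deriv b f (g x))" for b
      by (rule Suc.IH) (use Suc.prems in \<open>auto intro: Cn_on_SucD(3) Cn_on_Suc_imp\<close>)
    then show "Cn_on n S (\<lambda>x. \<Sum>b\<in>Basis. (dir_deriv v g x \<bullet> b) *\<^sub>R dir_deriv b f (g x))"
      using assms(1) Cn_on_SucD(3)[OF Suc.prems(2)]
      by (intro Cn_on_sum Cn_on_scaleR Cn_on_bounded_linear[OF _ bounded_linear_inner_left])
  qed
qed

lemma Cn_on_compose_Ck_maps:
  fixes X :: "'x topology" and A :: "('x, 'e::euclidean_space) chart set"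
    and z :: "'a::euclidean_space \<Rightarrow> 'x" and h :: "'x \<Rightarrow> 'v::euclidean_space"
  assumes manifold: "Ck_manifold M X A" and h_Ck: "Ck_map M X A euclidean std_atlas h"
    and z_Ck: "Ck_map M euclidean std_atlas X A z" and k_le: "enat k \<le> M"
  shows "Cn_on k UNIV (\<lambda>\<theta>. h (z \<theta>))"
proof (rule Cn_on_local)
  fix \<theta>
  have continuous: "continuous_map euclidean X z" using z_Ck by (simp add: Ck_map_def)
  then have "z \<theta> \<in> (\<Union>(U, \<phi>)\<in>A. U)"
    using manifold unfolding Ck_manifold_def by (auto simp: continuous_map_def)
  then obtain U \<phi> where U_chart: "(U, \<phi>) \<in> A" "z \<theta> \<in> U" by auto
  then have "is_chart X (U, \<phi>)" using manifold by (auto simp: Ck_manifold_def)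
  then have "openin X U" and homeo: "homeomorphic_map (subtopology X U) (top_of_set (\<phi> ` U)) \<phi>"
    by (auto simp: is_chart_def)
  then have inj: "inj_on \<phi> U"
    using homeomorphic_imp_injective_map[OF homeo] openin_subset[OF \<open>openin X U\<close>]
    by (simp add: Int_absorb1)
  have "open (z -` U)"
    using openin_continuous_map_preimage[OF continuous \<open>openin X U\<close>] by (simp add: vimage_def)
  have z_chart: "Cn_on k (z -` U) (\<lambda>\<theta>. \<phi> (z \<theta>))"
    using z_Ck k_le U_chart by (auto simp: Ck_map_def std_atlas_def Ck_on_def o_def)
  have h_chart: "Cn_on k (\<phi> ` U) (\<lambda>y. h (inv_into U \<phi> y))"
    using h_Ck k_le U_chart by (auto simp: Ck_map_def std_atlas_def Ck_on_def o_def)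
  have "Cn_on k (z -` U) (\<lambda>\<theta>. h (inv_into U \<phi> (\<phi> (z \<theta>))))"
    by (rule Cn_on_compose[OF \<open>open (z -` U)\<close> _ h_chart z_chart]) auto
  then have "Cn_on k (z -` U) (\<lambda>\<theta>. h (z \<theta>))"
    by (rule Cn_on_cong[OF \<open>open (z -` U)\<close>, rotated]) (simp add: inv_into_f_f[OF inj])
  with \<open>open (z -` U)\<close> U_chart show "\<exists>T. open T \<and> \<theta> \<in> T \<and> Cn_on k T (\<lambda>\<theta>. h (z \<theta>))" by blast
qed

section \<open>Finite differences\<close>

definition fdiff :: "'a::plus \<Rightarrow> ('a \<Rightarrow> 'b::minus) \<Rightarrow> 'a \<Rightarrow> 'b" where
  "fdiff u f x = f (x + u) - f x"

lemma has_derivative_fdiff: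
  fixes f :: "'a::real_normed_vector \<Rightarrow> 'b::real_normed_vector"
  assumes "\<And>x. f differentiable at x"
  shows "(fdiff u f has_derivative (\<lambda>v. fdiff u (dir_deriv v f) x)) (at x)"
proof -
  have "((\<lambda>x. f (x + u)) has_derivative (\<lambda>v. dir_deriv v f (x + u))) (at x)"
    by (rule has_derivative_compose[where f = "\<lambda>x. x + u" and f' = "\<lambda>v. v"])
      (auto intro!: derivative_eq_intros has_derivative_dir_deriv assms)
  from has_derivative_diff[OF this has_derivative_dir_deriv[OF assms]]
  show ?thesis by (simp add: fdiff_def[abs_def])
qed

lemma has_derivative_funpow_fdiff:
  fixes f :: "'a::real_normed_vector \<Rightarrow> 'b::real_normed_vector"
  assumes "\<And>x. f differentiable at x"
  shows "((fdiff u ^^ k) f has_derivative (\<lambda>v. (fdiff u ^^ k) (dir_deriv v f) x)) (at x)"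
proof (induction k arbitrary: x)
  case 0
  then show ?case using has_derivative_dir_deriv[OF assms] by simp
next
  case (Suc k)
  then have "dir_deriv v ((fdiff u ^^ k) f) = (fdiff u ^^ k) (dir_deriv v f)" for v
    using dir_deriv_eqI by blast
  then show ?case
    using has_derivative_fdiff[of "(fdiff u ^^ k) f" u x] Suc differentiable_def by force
qed

lemma norm_fdiff_le:
  fixes f :: "'a::real_normed_vector \<Rightarrow> 'b::real_normed_vector"
  assumes diff: "\<And>x. f differentiable at x" and dir_deriv_le: "\<And>x. norm (dir_deriv v f x) \<le> B"
  shows "norm (fdiff (s *\<^sub>R v) f x) \<le> \<bar>s\<bar> * B"
proof -
  have deriv: "((\<lambda>t. f (x + t *\<^sub>R (s *\<^sub>R v))) has_derivative
      (\<lambda>\<tau>. \<tau> *\<^sub>R (s *\<^sub>R dir_deriv v f (x + t *\<^sub>R (s *\<^sub>R v)))))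
      (at t within {0..1})" for t
  proof -
    have "((\<lambda>t. x + t *\<^sub>R (s *\<^sub>R v)) has_derivative (\<lambda>\<tau>. \<tau> *\<^sub>R (s *\<^sub>R v))) (at t within {0..1})"
      by (auto intro!: derivative_eq_intros)
    from has_derivative_compose[OF this has_derivative_dir_deriv[OF diff]]
    show ?thesis by (simp only: linear_cmul[OF linear_dir_deriv[OF diff]])
  qed
  have "norm (f (x + 1 *\<^sub>R (s *\<^sub>R v)) - f (x + 0 *\<^sub>R (s *\<^sub>R v))) \<le> \<bar>s\<bar> * B * norm (1 - 0 :: real)"
  proof (rule differentiable_bound[OF convex_real_interval(5) deriv])
    fix t :: real
    have "\<bar>\<tau>\<bar> * (\<bar>s\<bar> * norm (dir_deriv v f (x + t *\<^sub>R (s *\<^sub>R v)))) \<le> \<bar>\<tau>\<bar> * (\<bar>s\<bar> * B)" for \<tau>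
      by (intro mult_left_mono dir_deriv_le) auto
    then show "onorm (\<lambda>\<tau>. \<tau> *\<^sub>R (s *\<^sub>R dir_deriv v f (x + t *\<^sub>R (s *\<^sub>R v)))) \<le> \<bar>s\<bar> * B"
      by (intro onorm_le) (simp only: norm_scaleR real_norm_def mult_ac)
  qed auto
  then show ?thesis by (simp add: fdiff_def)
qed

lemma norm_funpow_fdiff_le:
  fixes f :: "'a::euclidean_space \<Rightarrow> 'b::real_normed_vector"
  assumes "Cn_on k UNIV f" "\<And>x. norm ((dir_deriv v ^^ k) f x) \<le> B"
  shows "norm ((fdiff (s *\<^sub>R v) ^^ k) f x) \<le> \<bar>s\<bar> ^ k * B"
  using assms
proof (induction k arbitrary: f x)
  case (Suc k)
  note diff = Cn_on_SucD(1)[OF Suc.prems(1) UNIV_I]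
  have "norm ((fdiff (s *\<^sub>R v) ^^ k) (dir_deriv v f) y) \<le> \<bar>s\<bar> ^ k * B" for y
    using Suc.prems by (intro Suc.IH Cn_on_SucD(3)) (simp_all only: funpow_Suc_right o_apply)
  with dir_deriv_eqI[OF has_derivative_funpow_fdiff, of f] diff
  have "norm (dir_deriv v ((fdiff (s *\<^sub>R v) ^^ k) f) y) \<le> \<bar>s\<bar> ^ k * B" for y
    by metis
  moreover have "(fdiff (s *\<^sub>R v) ^^ k) f differentiable at y" for y
    using has_derivative_funpow_fdiff diff unfolding differentiable_def by blast
  ultimately have "norm (fdiff (s *\<^sub>R v) ((fdiff (s *\<^sub>R v) ^^ k) f) x) \<le> \<bar>s\<bar> * (\<bar>s\<bar> ^ k * B)"
    by (intro norm_fdiff_le)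
  then show ?case by (simp add: mult.assoc)
qed simp

section \<open>Exponentials on the circle\<close>

definition circle_exp :: "real \<Rightarrow> complex" where
  "circle_exp x = cis (2 * pi * x)"

lemma circle_exp_0 [simp]: "circle_exp 0 = 1"
  by (simp add: circle_exp_def)

lemma circle_exp_of_int [simp]: "circle_exp (of_int k) = 1"
  by (simp add: circle_exp_def)

lemma norm_circle_exp [simp]: "norm (circle_exp x) = 1"
  by (simp add: circle_exp_def)

lemma circle_exp_add: "circle_exp (x + y) = circle_exp x * circle_exp y"
  by (simp add: circle_exp_def cis_mult distrib_left)

lemma circle_exp_diff: "circle_exp (x - y) = circle_exp x * circle_exp (- y)"
  using circle_exp_add[of x "- y"] by simp

lemma circle_exp_mult_of_nat: "circle_exp (real n * x) = circle_exp x ^ n"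
  by (induction n) (simp_all add: distrib_right circle_exp_add)

lemma circle_exp_sum: "circle_exp (\<Sum>i\<in>I. f i) = (\<Prod>i\<in>I. circle_exp (f i))"
  by (induction I rule: infinite_finite_induct) (simp_all add: circle_exp_add)

lemma continuous_on_circle_exp [continuous_intros]:
  "continuous_on S f \<Longrightarrow> continuous_on S (\<lambda>x. circle_exp (f x))"
  unfolding circle_exp_def by (intro continuous_intros)

lemma infdist_Ints: "infdist x \<int> = \<bar>x - of_int (round x)\<bar>" for x :: real
proof (rule antisym)
  have "(\<int> :: real set) \<noteq> {}" by (metis Ints_0 empty_iff)
  show "infdist x \<int> \<le> \<bar>x - of_int (round x)\<bar>"
    using infdist_le[of "of_int (round x)" \<int> x] by (simp add: dist_real_def)
  from \<open>\<int> \<noteq> {}\<close> show "\<bar>x - of_int (round x)\<bar> \<le> infdist x \<int>"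
    unfolding infdist_notempty[OF \<open>\<int> \<noteq> {}\<close>]
    by (rule cINF_greatest) (auto simp: dist_real_def round_diff_minimal elim!: Ints_cases)
qed

lemma le_infdist_Ints:
  "(\<And>l::int. \<delta> \<le> \<bar>x - of_int l\<bar>) \<Longrightarrow> \<delta> \<le> infdist x \<int>" for x :: real
  by (simp add: infdist_Ints)

lemma infdist_Ints_le: "infdist x \<int> \<le> \<bar>x - of_int l\<bar>" for x :: real
  by (simp add: infdist_Ints round_diff_minimal)

lemma infdist_Ints_le_half: "infdist x \<int> \<le> 1 / 2" for x :: real
  using of_int_round_abs_le[of x] by (simp add: infdist_Ints abs_minus_commute)

lemma infdist_Ints_small: "\<bar>x\<bar> < 1 / 2 \<Longrightarrow> infdist x \<int> = \<bar>x\<bar>" for x :: real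
  using round_unique'[of x 0] by (simp add: infdist_Ints)

lemma infdist_Ints_minus: "infdist (- x) \<int> = infdist x \<int>" for x :: real
proof -
  have "infdist y \<int> \<le> infdist (- y) \<int>" for y :: real
  proof (rule le_infdist_Ints)
    show "infdist y \<int> \<le> \<bar>- y - of_int l\<bar>" for l
      using infdist_Ints_le[of y "- l"] by simp
  qed
  from this[of x] this[of "- x"] show ?thesis by simp
qed

lemma infdist_Ints_add_of_nat: "infdist (x + real k) \<int> = infdist x \<int>"
proof (rule antisym)
  show "infdist (x + real k) \<int> \<le> infdist x \<int>"
  proof (rule le_infdist_Ints)
    show "infdist (x + real k) \<int> \<le> \<bar>x - of_int l\<bar>" for l
      using infdist_Ints_le[of "x + real k" "l + int k"] by simp
  qed
  show "infdist x \<int> \<le> infdist (x + real k) \<int>"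
  proof (rule le_infdist_Ints)
    show "infdist x \<int> \<le> \<bar>x + real k - of_int l\<bar>" for l
      using infdist_Ints_le[of x "l - int k"] by (simp add: algebra_simps)
  qed
qed

lemma infdist_Ints_fraction_ge:
  assumes "q > 0" "\<not> q dvd k"
  shows "1 / real q \<le> infdist (real k / real q) \<int>"
proof (rule le_infdist_Ints)
  fix l :: int
  have "int k \<noteq> l * int q" using assms(2) by (metis dvd_triv_right int_dvd_int_iff)
  then have "1 \<le> \<bar>int k - l * int q\<bar>" by linarith
  then have "1 \<le> real_of_int \<bar>int k - l * int q\<bar>" by linarith
  also have "\<dots> = \<bar>real k / real q - of_int l\<bar> * real q"
    using assms(1) by (simp add: abs_mult_pos left_diff_distrib)
  finally show "1 / real q \<le> \<bar>real k / real q - of_int l\<bar>"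
    using assms(1) by (simp add: divide_le_eq)
qed

lemma infdist_Ints_divide:
  fixes x :: real
  assumes "q > 0"
  shows "infdist x \<int> / real q \<le> infdist (x / real q) \<int>"
proof (rule le_infdist_Ints)
  fix l :: int
  have "infdist x \<int> \<le> \<bar>x - of_int (l * int q)\<bar>" by (rule infdist_Ints_le)
  also have "\<dots> = \<bar>x / real q - of_int l\<bar> * real q"
    using assms by (simp add: abs_mult_pos left_diff_distrib)
  finally show "infdist x \<int> / real q \<le> \<bar>x / real q - of_int l\<bar>"
    using assms by (simp add: divide_le_eq)
qed

lemma jordan_sin_inequality:
  assumes "0 \<le> x" "x \<le> pi / 2"
  shows "2 * x / pi \<le> sin x"
proof -
  have "convex_on {0..pi/2} (\<lambda>x. - sin x)"
  proof (rule f''_ge0_imp_convex)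
    show "((\<lambda>x. - sin x) has_real_derivative - cos x) (at x)" for x
      by (auto intro!: derivative_eq_intros)
    show "((\<lambda>x. - cos x) has_real_derivative sin x) (at x)" for x
      by (auto intro!: derivative_eq_intros)
    show "0 \<le> sin x" if "x \<in> {0..pi/2}" for x
      using that by (intro sin_ge_zero) auto
  qed auto
  from convex_onD_Icc[OF this, of "2 * x / pi"] show ?thesis
    using assms by (auto simp: field_simps)
qed

lemma norm_circle_exp_minus_1_ge: "4 * infdist x \<int> \<le> norm (circle_exp x - 1)"
proof -
  define y where "y = x - of_int (round x)"
  have abs_y: "\<bar>y\<bar> = infdist x \<int>" by (simp add: y_def infdist_Ints)
  have "circle_exp x = circle_exp y"
    using circle_exp_add[of y "of_int (round x)"] by (simp add: y_def)
  then have "norm (circle_exp x - 1) = 2 * \<bar>sin (pi * y)\<bar>"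
    using dist_exp_i_1[of "2 * pi * y"] by (simp add: circle_exp_def cis_conv_exp)
  also have "\<bar>sin (pi * y)\<bar> = \<bar>sin (pi * \<bar>y\<bar>)\<bar>" by (simp add: abs_if)
  finally have "norm (circle_exp x - 1) = 2 * \<bar>sin (pi * \<bar>y\<bar>)\<bar>" .
  moreover have "2 * \<bar>y\<bar> \<le> sin (pi * \<bar>y\<bar>)"
    using jordan_sin_inequality[of "pi * \<bar>y\<bar>"] infdist_Ints_le_half[of x]
    by (simp add: abs_y infdist_nonneg)
  ultimately show ?thesis by (simp add: abs_y)
qed

lemma circle_exp_eq_1_iff: "circle_exp x = 1 \<longleftrightarrow> x \<in> \<int>"
proof
  assume "circle_exp x = 1"
  then have "infdist x \<int> = 0"
    using norm_circle_exp_minus_1_ge[of x] infdist_nonneg[of x \<int>] by simp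
  then have "x = of_int (round x)" by (simp add: infdist_Ints)
  then show "x \<in> \<int>" by (metis Ints_of_int)
qed (auto elim: Ints_cases)

lemma sum_circle_exp:
  assumes "q > 0"
  shows "(\<Sum>r<q. circle_exp (real r * (of_int k / real q))) = (if int q dvd k then of_nat q else 0)"
proof -
  let ?\<zeta> = "circle_exp (of_int k / real q)"
  have "?\<zeta> = 1 \<longleftrightarrow> int q dvd k"
  proof
    show "int q dvd k" if "?\<zeta> = 1"
      using that fraction_not_in_Ints[of "int q" k, where 'a = real] assms
      by (auto simp: circle_exp_eq_1_iff)
    show "?\<zeta> = 1" if "int q dvd k"
      using that assms by (auto elim!: dvdE)
  qed
  moreover have "?\<zeta> ^ q = 1"
    using assms by (simp flip: circle_exp_mult_of_nat)
  ultimately show ?thesis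
    by (cases "int q dvd k")
      (simp_all only: circle_exp_mult_of_nat power_one, simp_all add: geometric_sum)
qed

section \<open>Functions on the torus\<close>

definition torus_periodic :: "(real ^ 'd \<Rightarrow> 'v) \<Rightarrow> bool" where
  "torus_periodic f \<longleftrightarrow> (\<forall>x n. f (x + int_vec n) = f x)"

definition torus_character :: "int ^ 'd \<Rightarrow> real ^ 'd \<Rightarrow> complex" where
  "torus_character n x = circle_exp (int_vec n \<bullet> x)"

lemma torus_periodicD: "torus_periodic f \<Longrightarrow> f (x + int_vec n) = f x"
  by (simp add: torus_periodic_def)

lemma int_vec_nth [simp]: "int_vec n $ i = of_int (n $ i)"
  by (simp add: int_vec_def)

lemma int_vec_0 [simp]: "int_vec 0 = 0"
  by (simp add: vec_eq_iff)

lemma inner_int_vec: "int_vec m \<bullet> int_vec n = of_int (\<Sum>i\<in>UNIV. m $ i * n $ i)"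
  by (simp add: inner_vec_def)

lemma norm_torus_character [simp]: "norm (torus_character n x) = 1"
  by (simp add: torus_character_def)

lemma torus_character_0 [simp]: "torus_character 0 x = 1"
  by (simp add: torus_character_def)

lemma torus_character_add: "torus_character n (x + y) = torus_character n x * torus_character n y"
  by (simp add: torus_character_def inner_right_distrib circle_exp_add)

lemma torus_character_minus_shift:
  "torus_character n (- x) = torus_character n u * torus_character n (- (x + u))"
  using torus_character_add[of n u "- (x + u)"] by simp

lemma torus_character_multiple:
  "torus_character n (real l *\<^sub>R \<omega>) = circle_exp ((\<omega> \<bullet> int_vec n) * real l)"
  by (simp add: torus_character_def inner_commute mult.commute)

lemma continuous_on_torus_character [continuous_intros]:
  "continuous_on S f \<Longrightarrow> continuous_on S (\<lambda>x. torus_character n (f x))"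
  unfolding torus_character_def by (intro continuous_intros)

lemma torus_character_minus_add_int_vec:
  "torus_character n (- (x + int_vec m)) = torus_character n (- x)"
proof -
  have "torus_character n (- int_vec m) = circle_exp (of_int (- (\<Sum>i\<in>UNIV. n $ i * m $ i)))"
    by (simp add: torus_character_def inner_int_vec)
  also have "\<dots> = 1" by (rule circle_exp_of_int)
  finally show ?thesis using torus_character_add[of n "- x" "- int_vec m"] by simp
qed

lemma torus_periodic_translate: "torus_periodic f \<Longrightarrow> torus_periodic (\<lambda>x. f (\<theta> + x))"
  unfolding torus_periodic_def by (metis add.assoc)

lemma torus_periodic_mult_character:
  "torus_periodic f \<Longrightarrow> torus_periodic (\<lambda>x. f x * torus_character n (- x))"
  unfolding torus_periodic_def torus_character_minus_add_int_vec by simp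

lemma torus_representative:
  obtains n where "x + int_vec n \<in> cbox 0 (1 :: real ^ 'd)"
proof
  show "x + int_vec (\<chi> i. - \<lfloor>x $ i\<rfloor>) \<in> cbox 0 1"
    by (simp add: mem_box_cart) linarith
qed

lemma torus_periodic_bounded:
  fixes f :: "real ^ 'd \<Rightarrow> 'v::real_normed_vector"
  assumes "torus_periodic f" "continuous_on UNIV f"
  shows "bounded (range f)"
proof -
  have "range f \<subseteq> f ` cbox 0 1"
  proof clarify
    fix x
    obtain n where "x + int_vec n \<in> cbox 0 (1 :: real ^ 'd)" by (rule torus_representative)
    then show "f x \<in> f ` cbox 0 1" using torus_periodicD[OF assms(1), of x n] by (metis image_eqI)
  qed
  moreover have "compact (f ` cbox 0 1)"
    by (intro compact_continuous_image continuous_on_subset[OF assms(2)]) auto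
  ultimately show ?thesis by (meson bounded_subset compact_imp_bounded)
qed

lemma torus_periodic_uniformly_continuous:
  fixes f :: "real ^ 'd \<Rightarrow> 'v::real_normed_vector"
  assumes "torus_periodic f" "continuous_on UNIV f"
  shows "uniformly_continuous_on UNIV f"
  unfolding uniformly_continuous_on_def
proof (intro allI impI)
  fix e :: real assume "e > 0"
  let ?K = "cbox (-1) 2 :: (real ^ 'd) set"
  have "uniformly_continuous_on ?K f"
    by (intro compact_uniformly_continuous continuous_on_subset[OF assms(2)]) auto
  then obtain d where modulus: "d > 0" "\<And>x y. x \<in> ?K \<Longrightarrow> y \<in> ?K \<Longrightarrow> dist y x < d \<Longrightarrow> dist (f y) (f x) < e"
    using \<open>e > 0\<close> unfolding uniformly_continuous_on_def by metis
  have "dist (f y) (f x) < e" if "dist y x < min d 1" for x y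
  proof -
    obtain n where representative: "x + int_vec n \<in> cbox 0 (1 :: real ^ 'd)"
      by (rule torus_representative)
    have "\<bar>y $ i - x $ i\<bar> \<le> 1" for i
      using component_le_norm_cart[of "y - x" i] that by (simp add: dist_norm)
    then have "x + int_vec n \<in> ?K" "y + int_vec n \<in> ?K"
      using representative by (auto simp: mem_box_cart abs_le_iff algebra_simps) (smt (verit))+
    then have "dist (f (y + int_vec n)) (f (x + int_vec n)) < e" using that by (intro modulus) auto
    then show ?thesis by (simp add: torus_periodicD[OF assms(1)])
  qed
  then show "\<exists>d>0. \<forall>x\<in>UNIV. \<forall>x'\<in>UNIV. dist x' x < d \<longrightarrow> dist (f x') (f x) < e"
    using modulus(1) by (intro exI[of _ "min d 1"]) auto
qed

lemma torus_periodic_dir_deriv: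
  assumes "torus_periodic f" "\<And>x. f differentiable at x"
  shows "torus_periodic (dir_deriv v f)"
  unfolding torus_periodic_def
proof (intro allI)
  fix x n
  have "((\<lambda>y. f (y + int_vec n)) has_derivative (\<lambda>v. dir_deriv v f (x + int_vec n))) (at x)"
    by (rule has_derivative_compose[where f = "\<lambda>y. y + int_vec n" and f' = "\<lambda>v. v"])
      (auto intro!: derivative_eq_intros has_derivative_dir_deriv assms)
  then have "(f has_derivative (\<lambda>v. dir_deriv v f (x + int_vec n))) (at x)"
    by (simp add: torus_periodicD[OF assms(1)])
  then show "dir_deriv v f (x + int_vec n) = dir_deriv v f x" by (rule dir_deriv_eqI[symmetric])
qed

lemma torus_periodic_funpow_dir_deriv:
  "torus_periodic f \<Longrightarrow> Cn_on k UNIV f \<Longrightarrow> torus_periodic ((dir_deriv v ^^ k) f)"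
proof (induction k arbitrary: f)
  case (Suc k)
  then show ?case
    by (simp only: funpow_Suc_right o_apply) (blast intro: torus_periodic_dir_deriv Cn_on_SucD)
qed simp

lemma torus_periodic_fdiff: "torus_periodic f \<Longrightarrow> torus_periodic (fdiff u f)"
  unfolding torus_periodic_def fdiff_def by (metis add.assoc add.commute)

lemma torus_periodic_funpow_fdiff: "torus_periodic f \<Longrightarrow> torus_periodic ((fdiff u ^^ k) f)"
  by (induction k) (auto intro: torus_periodic_fdiff)

lemma torus_periodic_funpow_fdiff_bound:
  fixes f :: "real ^ 'd \<Rightarrow> 'v::real_normed_vector"
  assumes "torus_periodic f" "Cn_on k UNIV f"
  obtains B where "\<And>s x. norm ((fdiff (s *\<^sub>R v) ^^ k) f x) \<le> \<bar>s\<bar> ^ k * B"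
proof -
  have "bounded (range ((dir_deriv v ^^ k) f))"
    by (intro torus_periodic_bounded torus_periodic_funpow_dir_deriv continuous_on_funpow_dir_deriv assms)
  then obtain B where "\<And>x. norm ((dir_deriv v ^^ k) f x) \<le> B" by (auto simp: bounded_iff)
  then show thesis using norm_funpow_fdiff_le[OF assms(2)] that by blast
qed

section \<open>Lattice sums\<close>

definition freq_size :: "int ^ 'd \<Rightarrow> real" where
  "freq_size n = max 1 (norm (int_vec n))"

lemma freq_size_pos: "freq_size n > 0"
  by (simp add: freq_size_def less_max_iff_disj)

lemma norm_int_vec_ge_1:
  assumes "n \<noteq> 0"
  shows "norm (int_vec n) \<ge> 1"
proof -
  obtain i where "n $ i \<noteq> 0" using assms by (auto simp: vec_eq_iff)
  then have "1 \<le> \<bar>int_vec n $ i\<bar>" by simp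
  also have "\<dots> \<le> norm (int_vec n)" by (rule component_le_norm_cart)
  finally show ?thesis .
qed

lemma freq_size_eq_norm: "n \<noteq> 0 \<Longrightarrow> freq_size n = norm (int_vec n)"
  using norm_int_vec_ge_1[of n] by (simp add: freq_size_def)

lemma freq_size_0 [simp]: "freq_size 0 = 1"
  by (simp add: freq_size_def)

lemma summable_on_int_powr:
  assumes "\<sigma> > 1"
  shows "(\<lambda>k::int. max 1 \<bar>real_of_int k\<bar> powr - \<sigma>) summable_on UNIV"
proof -
  let ?g = "\<lambda>k::int. max 1 \<bar>real_of_int k\<bar> powr - \<sigma>"
  have "summable (\<lambda>k. real k powr - \<sigma>)" using assms by (simp add: summable_real_powr_iff)
  then have "summable (\<lambda>k. max 1 (real k) powr - \<sigma>)"
    by (rule summable_cong[THEN iffD1, rotated]) (auto intro: eventually_sequentiallyI[of 1])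
  then have summable_nat: "(\<lambda>k. max 1 (real k) powr - \<sigma>) summable_on UNIV"
    by (simp add: summable_on_UNIV_nonneg_real_iff)
  have "?g summable_on range int"
    by (subst summable_on_reindex) (use summable_nat in \<open>auto simp: o_def\<close>)
  moreover have "?g summable_on range (\<lambda>k. - int k)"
    by (subst summable_on_reindex) (use summable_nat in \<open>auto simp: o_def inj_on_def\<close>)
  moreover have "UNIV = range int \<union> range (\<lambda>k. - int k)"
    by (auto intro: int_cases2)
  ultimately show ?thesis using summable_on_union by metis
qed

lemma integrable_count_space_iff_summable_on:
  fixes f :: "'a \<Rightarrow> real"
  shows "integrable (count_space A) f \<longleftrightarrow> f summable_on A"
  unfolding abs_summable_on_def[symmetric] abs_summable_equivalent[symmetric]
  by (rule summable_on_iff_abs_summable_on_real[symmetric])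

lemma summable_on_prod_vec:
  fixes f :: "int \<Rightarrow> real"
  assumes "f summable_on UNIV"
  shows "(\<lambda>n :: int ^ 'd. \<Prod>i\<in>UNIV. f (n $ i)) summable_on UNIV"
proof -
  have "Infinite_Set_Sum.abs_summable_on (\<lambda>g :: 'd \<Rightarrow> int. \<Prod>i\<in>UNIV. f (g i)) (PiE UNIV (\<lambda>_. UNIV))"
    using assms by (intro abs_summable_on_prod_PiE)
      (auto simp: abs_summable_on_def integrable_count_space_iff_summable_on)
  then have "(\<lambda>g :: 'd \<Rightarrow> int. \<Prod>i\<in>UNIV. f (g i)) summable_on UNIV"
    by (simp add: abs_summable_on_def integrable_count_space_iff_summable_on PiE_UNIV_domain)
  moreover have "bij_betw (vec_nth :: int ^ 'd \<Rightarrow> 'd \<Rightarrow> int) UNIV UNIV"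
    by (rule bij_betw_byWitness[where f' = vec_lambda]) auto
  ultimately show ?thesis
    by (subst summable_on_reindex_bij_betw[where f = "\<lambda>g. \<Prod>i\<in>UNIV. f (g i)"])
qed

lemma summable_on_freq_size_powr:
  assumes "real CARD('d) < t"
  shows "(\<lambda>n :: int ^ 'd. freq_size n powr - t) summable_on UNIV"
proof -
  define \<sigma> where "\<sigma> = t / real CARD('d)"
  have "\<sigma> > 1" using assms by (simp add: \<sigma>_def)
  then have "(\<lambda>n :: int ^ 'd. \<Prod>i\<in>UNIV. max 1 \<bar>real_of_int (n $ i)\<bar> powr - \<sigma>) summable_on UNIV"
    by (intro summable_on_prod_vec summable_on_int_powr)
  moreover have "freq_size n powr - t
      \<le> (\<Prod>i\<in>UNIV. max 1 \<bar>real_of_int (n $ i)\<bar> powr - \<sigma>)" for n :: "int ^ 'd"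
  proof -
    have "freq_size n powr - t = (freq_size n powr - \<sigma>) powr real CARD('d)"
      by (simp add: powr_powr \<sigma>_def)
    also have "\<dots> = (\<Prod>i\<in>(UNIV :: 'd set). freq_size n powr - \<sigma>)"
      using freq_size_pos[of n] by (simp add: powr_realpow)
    also have "\<dots> \<le> (\<Prod>i\<in>UNIV. max 1 \<bar>real_of_int (n $ i)\<bar> powr - \<sigma>)"
    proof (intro prod_mono conjI powr_mono2')
      show "max 1 \<bar>real_of_int (n $ i)\<bar> \<le> freq_size n" for i
        using component_le_norm_cart[of "int_vec n" i] by (simp add: freq_size_def)
    qed (use \<open>\<sigma> > 1\<close> in auto)
    finally show ?thesis .
  qed
  ultimately show ?thesis by (rule summable_on_comparison_test) auto
qed

lemma has_sum_dominated_convergence: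
  fixes g :: "nat \<Rightarrow> 'a \<Rightarrow> 'b::{banach, second_countable_topology}" and D :: "'a \<Rightarrow> real"
  assumes D_summable: "D summable_on UNIV" and bound: "\<And>r x. norm (g r x) \<le> D x"
    and lim: "\<And>x. (\<lambda>r. g r x) \<longlonglongrightarrow> b x"
    and sums: "\<And>r. (g r has_sum c r) UNIV" and c_tendsto: "c \<longlonglongrightarrow> l"
  shows "(b has_sum l) UNIV"
proof -
  have "integrable (count_space UNIV) D"
    using D_summable by (simp add: integrable_count_space_iff_summable_on)
  note dominated = borel_measurable_count_space borel_measurable_count_space this
    AE_I2[OF lim] AE_I2[OF bound]
  have summable: "Infinite_Set_Sum.abs_summable_on b UNIV"
    "Infinite_Set_Sum.abs_summable_on (g r) UNIV" for r
    unfolding abs_summable_on_def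
    by (rule integrable_dominated_convergence[OF dominated],
        rule integrable_dominated_convergence2[OF dominated])
  have "(\<lambda>r. infsetsum (g r) UNIV) \<longlonglongrightarrow> infsetsum b UNIV"
    unfolding infsetsum_def by (rule integral_dominated_convergence[OF dominated])
  moreover have "infsetsum (g r) UNIV = c r" for r
    using infsetsum_infsum[OF summable(2)] sums by (simp add: infsumI)
  ultimately have "infsum b UNIV = l"
    using infsetsum_infsum[OF summable(1)] LIMSEQ_unique[OF _ c_tendsto] by simp
  moreover have "b summable_on UNIV"
    using summable(1) abs_summable_equivalent abs_summable_summable by blast
  ultimately show ?thesis by (simp add: has_sum_iff)
qed

definition lattice_box :: "int set \<Rightarrow> (int ^ 'd) set" where
  "lattice_box S = {v. \<forall>i. v $ i \<in> S}"

lemma bij_betw_vec_lambda_lattice_box: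
  "bij_betw vec_lambda (PiE UNIV (\<lambda>_. S)) (lattice_box S :: (int ^ 'd) set)"
  by (rule bij_betw_byWitness[where f' = vec_nth]) (auto simp: lattice_box_def)

lemma finite_lattice_box [simp]: "finite S \<Longrightarrow> finite (lattice_box S :: (int ^ 'd) set)"
  using bij_betw_finite[OF bij_betw_vec_lambda_lattice_box] finite_PiE by (metis finite)

lemma sum_prod_lattice_box:
  fixes g :: "'d::finite \<Rightarrow> int \<Rightarrow> 'a::comm_semiring_1"
  assumes "finite S"
  shows "(\<Sum>v\<in>lattice_box S. \<Prod>i\<in>UNIV. g i (v $ i)) = (\<Prod>i\<in>UNIV. \<Sum>y\<in>S. g i y)"
  by (subst prod_sum_PiE)
    (use assms sum.reindex_bij_betw[OF bij_betw_vec_lambda_lattice_box,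
        of "\<lambda>v. \<Prod>i\<in>UNIV. g i (v $ i)"] in auto)

lemma card_lattice_box:
  "finite S \<Longrightarrow> card (lattice_box S :: (int ^ 'd) set) = card S ^ CARD('d)"
  using sum_prod_lattice_box[of S "\<lambda>(_ :: 'd) _. 1 :: nat"] by simp

lemma eventually_mem_lattice_box:
  "\<forall>\<^sub>F r in sequentially. (n :: int ^ 'd) \<in> lattice_box {- int r..int r}"
proof (rule eventually_sequentiallyI)
  fix r assume r_ge: "nat (\<Sum>i\<in>UNIV. \<bar>n $ i\<bar>) \<le> r"
  have "\<bar>n $ i\<bar> \<le> int r" for i
    using r_ge member_le_sum[of i UNIV "\<lambda>i. \<bar>n $ i\<bar>"] by auto
  then show "n \<in> lattice_box {- int r..int r}" by (auto simp: lattice_box_def abs_le_iff minus_le_iff)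
qed

section \<open>Grid means\<close>

definition grid_mean :: "nat \<Rightarrow> (real ^ 'd \<Rightarrow> 'v::real_vector) \<Rightarrow> 'v" where
  "grid_mean q \<phi> = (\<Sum>j\<in>lattice_box {0..<int q}. \<phi> (int_vec j /\<^sub>R real q)) /\<^sub>R real (q ^ CARD('d))"

lemma grid_mean_cmult:
  fixes \<phi> :: "real ^ 'd \<Rightarrow> 'v::real_algebra"
  shows "grid_mean q (\<lambda>x. c * \<phi> x) = c * grid_mean q \<phi>"
  by (simp add: grid_mean_def sum_distrib_left)

lemma grid_mean_diff: "grid_mean q (\<lambda>x. \<phi> x - \<psi> x) = grid_mean q \<phi> - grid_mean q \<psi>"
  by (simp add: grid_mean_def sum_subtractf scaleR_diff_right)

lemma grid_mean_const: "q > 0 \<Longrightarrow> grid_mean q (\<lambda>x. c) = c"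
  by (simp add: grid_mean_def card_lattice_box sum_constant_scaleR)

lemma grid_mean_swap:
  "grid_mean q (\<lambda>x. grid_mean q' (\<lambda>y. \<phi> x y)) = grid_mean q' (\<lambda>y. grid_mean q (\<lambda>x. \<phi> x y))"
  unfolding grid_mean_def scaleR_sum_right
  by (subst sum.swap) (simp add: mult.commute)

lemma norm_grid_mean_le:
  fixes \<phi> :: "real ^ 'd \<Rightarrow> 'v::real_normed_vector"
  assumes "\<And>x. norm (\<phi> x) \<le> B"
  shows "norm (grid_mean q \<phi>) \<le> B"
proof (cases "q = 0")
  case True
  then show ?thesis using order_trans[OF norm_ge_zero assms] by (simp add: grid_mean_def zero_power)
next
  case False
  have "norm (\<Sum>j\<in>lattice_box {0..<int q}. \<phi> (int_vec j /\<^sub>R real q))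
      \<le> real (card (lattice_box {0..<int q} :: (int ^ 'd) set)) * B"
    by (intro sum_norm_bound assms)
  then show ?thesis using False by (simp add: grid_mean_def card_lattice_box field_simps)
qed

lemma sum_lattice_box_mod_shift:
  fixes g :: "int ^ 'd \<Rightarrow> 'v::comm_monoid_add"
  assumes "q > 0" and periodic: "\<And>j n. g (j + int q *s n) = g j"
  shows "(\<Sum>j\<in>lattice_box {0..<int q}. g (j + s)) = (\<Sum>j\<in>lattice_box {0..<int q}. g j)"
proof -
  define reduce :: "int ^ 'd \<Rightarrow> int ^ 'd" where "reduce j = (\<chi> i. j $ i mod int q)" for j
  have "bij_betw (\<lambda>j. reduce (j + s)) (lattice_box {0..<int q}) (lattice_box {0..<int q})"
    by (rule bij_betw_byWitness[where f' = "\<lambda>j. reduce (j - s)"])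
      (use assms(1) in \<open>auto simp: reduce_def lattice_box_def vec_eq_iff mod_diff_left_eq mod_add_left_eq\<close>)
  then have "(\<Sum>j\<in>lattice_box {0..<int q}. g (reduce (j + s))) = (\<Sum>j\<in>lattice_box {0..<int q}. g j)"
    by (rule sum.reindex_bij_betw)
  moreover have "g j = g (reduce j)" for j
  proof -
    have "j = reduce j + int q *s (\<chi> i. j $ i div int q)" by (simp add: reduce_def vec_eq_iff)
    then show ?thesis using periodic by metis
  qed
  ultimately show ?thesis by simp
qed

lemma grid_mean_shift:
  assumes "q > 0" "torus_periodic \<phi>"
  shows "grid_mean q (\<lambda>x. \<phi> (x + int_vec s /\<^sub>R real q)) = grid_mean q \<phi>"
proof -
  have grid_add: "int_vec (i + j) /\<^sub>R real q =
      int_vec i /\<^sub>R real q + int_vec j /\<^sub>R real q" for i j :: "int ^ 'd"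
    by (simp add: vec_eq_iff distrib_left)
  have grid_multiple: "int_vec (int q *s n) /\<^sub>R real q = int_vec n" for n :: "int ^ 'd"
    using assms(1) by (simp add: vec_eq_iff)
  have "(\<Sum>j\<in>lattice_box {0..<int q}. \<phi> (int_vec (j + s) /\<^sub>R real q)) =
      (\<Sum>j\<in>lattice_box {0..<int q}. \<phi> (int_vec j /\<^sub>R real q))"
    by (rule sum_lattice_box_mod_shift[OF assms(1)])
      (simp only: grid_add grid_multiple torus_periodicD[OF assms(2)])
  then show ?thesis by (simp only: grid_mean_def grid_add)
qed

lemma ex_grid_point_close:
  assumes "q > 0"
  shows "\<exists>s. norm (\<tau> - int_vec s /\<^sub>R real q :: real ^ 'd) \<le> real CARD('d) / real q"
proof
  let ?s = "(\<chi> i. \<lfloor>real q * \<tau> $ i\<rfloor>) :: int ^ 'd"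
  have "\<bar>(\<tau> - int_vec ?s /\<^sub>R real q) $ i\<bar> \<le> 1 / real q" for i
  proof -
    have "(\<tau> - int_vec ?s /\<^sub>R real q) $ i = (real q * \<tau> $ i - of_int \<lfloor>real q * \<tau> $ i\<rfloor>) / real q"
      using assms by (simp add: field_simps)
    also have "\<bar>\<dots>\<bar> = \<bar>real q * \<tau> $ i - of_int \<lfloor>real q * \<tau> $ i\<rfloor>\<bar> / real q" by simp
    also have "\<dots> \<le> 1 / real q" by (rule divide_right_mono) linarith+
    finally show ?thesis .
  qed
  then have "(\<Sum>i\<in>UNIV. \<bar>(\<tau> - int_vec ?s /\<^sub>R real q) $ i\<bar>) \<le> (\<Sum>i\<in>(UNIV :: 'd set). 1 / real q)"
    by (rule sum_mono)
  then show "norm (\<tau> - int_vec ?s /\<^sub>R real q) \<le> real CARD('d) / real q"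
    using norm_le_l1_cart[of "\<tau> - int_vec ?s /\<^sub>R real q"] by simp
qed

lemma eventually_grid_mean_translate:
  fixes \<phi> :: "real ^ 'd \<Rightarrow> 'v::real_normed_vector"
  assumes periodic: "torus_periodic \<phi>" and continuous: "continuous_on UNIV \<phi>" and "e > 0"
  shows "\<forall>\<^sub>F q in sequentially. \<forall>\<tau>. norm (grid_mean q (\<lambda>x. \<phi> (x + \<tau>)) - grid_mean q \<phi>) \<le> e"
proof -
  obtain d where "d > 0" and modulus: "\<And>x y. dist x y < d \<Longrightarrow> dist (\<phi> x) (\<phi> y) < e"
    using torus_periodic_uniformly_continuous[OF periodic continuous] \<open>e > 0\<close>
    unfolding uniformly_continuous_on_def by (metis UNIV_I)
  have "(\<lambda>q. real CARD('d) / real q) \<longlonglongrightarrow> 0"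
    by (rule lim_const_over_n)
  then have "\<forall>\<^sub>F q in sequentially. real CARD('d) / real q < d"
    by (rule order_tendstoD(2)) (rule \<open>d > 0\<close>)
  then show ?thesis
    using eventually_gt_at_top[of 0]
  proof eventually_elim
    case (elim q)
    show ?case
    proof
      fix \<tau> :: "real ^ 'd"
      obtain s where s_close: "norm (\<tau> - int_vec s /\<^sub>R real q) < d"
        using ex_grid_point_close[OF elim(2)] elim(1) by (meson order_le_less_trans)
      have "norm (\<phi> (x + \<tau>) - \<phi> (x + int_vec s /\<^sub>R real q)) \<le> e" for x
        using modulus[of "x + \<tau>" "x + int_vec s /\<^sub>R real q"] s_close by (simp add: dist_norm)
      then have "norm (grid_mean q (\<lambda>x. \<phi> (x + \<tau>) - \<phi> (x + int_vec s /\<^sub>R real q))) \<le> e"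
        by (rule norm_grid_mean_le)
      then show "norm (grid_mean q (\<lambda>x. \<phi> (x + \<tau>)) - grid_mean q \<phi>) \<le> e"
        by (simp add: grid_mean_diff grid_mean_shift[OF elim(2) periodic])
    qed
  qed
qed

text \<open>Averaging \<open>\<phi> (x + y)\<close> over a grid in \<open>x\<close> and another one in \<open>y\<close> is close to both averages.\<close>

lemma convergent_grid_mean:
  fixes \<phi> :: "real ^ 'd \<Rightarrow> 'v::banach"
  assumes periodic: "torus_periodic \<phi>" and continuous: "continuous_on UNIV \<phi>"
  shows "convergent (\<lambda>q. grid_mean q \<phi>)"
proof (rule Cauchy_convergent, rule metric_CauchyI)
  fix e :: real assume "e > 0"
  then obtain Q where translate_close:
      "\<And>q \<tau>. q \<ge> Q \<Longrightarrow> norm (grid_mean q (\<lambda>x. \<phi> (x + \<tau>)) - grid_mean q \<phi>) \<le> e / 3"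
    using eventually_grid_mean_translate[OF periodic continuous, of "e / 3"]
    by (auto simp: eventually_sequentially)
  have close: "norm (grid_mean q (\<lambda>y. grid_mean q' (\<lambda>x. \<phi> (x + y))) - grid_mean q' \<phi>) \<le> e / 3"
    if "q > 0" "q' \<ge> Q" for q q'
  proof -
    have "norm (grid_mean q (\<lambda>y. grid_mean q' (\<lambda>x. \<phi> (x + y)) - grid_mean q' \<phi>)) \<le> e / 3"
      by (rule norm_grid_mean_le) (rule translate_close[OF that(2)])
    then show ?thesis by (simp add: grid_mean_diff grid_mean_const[OF that(1)])
  qed
  have "dist (grid_mean q \<phi>) (grid_mean q' \<phi>) < e" if "q \<ge> Suc Q" "q' \<ge> Suc Q" for q q'
  proof -
    have "grid_mean q (\<lambda>y. grid_mean q' (\<lambda>x. \<phi> (x + y))) =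
        grid_mean q' (\<lambda>y. grid_mean q (\<lambda>x. \<phi> (x + y)))"
      by (subst grid_mean_swap) (simp add: add.commute)
    then show ?thesis
      using close[of q q'] close[of q' q] that \<open>e > 0\<close>
        dist_triangle3[of "grid_mean q \<phi>" "grid_mean q' \<phi>"
          "grid_mean q (\<lambda>y. grid_mean q' (\<lambda>x. \<phi> (x + y)))"]
      by (simp add: dist_norm)
  qed
  then show "\<exists>M. \<forall>m\<ge>M. \<forall>n\<ge>M. dist (grid_mean m \<phi>) (grid_mean n \<phi>) < e" by blast
qed

section \<open>Fourier series of smooth periodic functions\<close>

definition grid_coeff :: "nat \<Rightarrow> (real ^ 'd \<Rightarrow> complex) \<Rightarrow> real ^ 'd \<Rightarrow> int ^ 'd \<Rightarrow> complex" where
  "grid_coeff q f \<theta> n = grid_mean q (\<lambda>x. f (\<theta> + x) * torus_character n (- x))"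

lemma grid_coeff_tendsto:
  fixes f :: "real ^ 'd \<Rightarrow> complex"
  assumes periodic: "torus_periodic f" and continuous: "continuous_on UNIV f"
  obtains a where "\<And>n \<theta>. (\<lambda>q. grid_coeff q f \<theta> n) \<longlonglongrightarrow> a n * torus_character n \<theta>"
proof -
  define \<phi> where "\<phi> n x = f x * torus_character n (- x)" for n x
  have periodic_\<phi>: "torus_periodic (\<phi> n)" for n
    unfolding \<phi>_def[abs_def] by (rule torus_periodic_mult_character[OF periodic])
  have continuous_\<phi>: "continuous_on UNIV (\<phi> n)" for n
    unfolding \<phi>_def[abs_def] by (intro continuous_intros continuous)
  obtain a where mean_tendsto: "\<And>n. (\<lambda>q. grid_mean q (\<phi> n)) \<longlonglongrightarrow> a n"
    using convergent_grid_mean[OF periodic_\<phi> continuous_\<phi>] unfolding convergent_def by metis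
  have "(\<lambda>q. grid_coeff q f \<theta> n) \<longlonglongrightarrow> a n * torus_character n \<theta>" for n \<theta>
  proof -
    have "(\<lambda>q. grid_mean q (\<lambda>x. \<phi> n (x + \<theta>)) - grid_mean q (\<phi> n)) \<longlonglongrightarrow> 0"
    proof (rule tendstoI)
      fix e :: real assume "e > 0"
      with eventually_grid_mean_translate[OF periodic_\<phi> continuous_\<phi>, of "e / 2" n]
      have "\<forall>\<^sub>F q in sequentially. \<forall>\<tau>. norm (grid_mean q (\<lambda>x. \<phi> n (x + \<tau>)) - grid_mean q (\<phi> n)) \<le> e / 2"
        by simp
      then show "\<forall>\<^sub>F q in sequentially. dist (grid_mean q (\<lambda>x. \<phi> n (x + \<theta>)) - grid_mean q (\<phi> n)) 0 < e"
      proof eventually_elim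
        case (elim q)
        then have "norm (grid_mean q (\<lambda>x. \<phi> n (x + \<theta>)) - grid_mean q (\<phi> n)) \<le> e / 2" by blast
        then show ?case using \<open>e > 0\<close> by simp
      qed
    qed
    from tendsto_add[OF this mean_tendsto[of n]]
    have "(\<lambda>q. torus_character n \<theta> * grid_mean q (\<lambda>x. \<phi> n (x + \<theta>))) \<longlonglongrightarrow> torus_character n \<theta> * a n"
      by (intro tendsto_mult_left) simp
    moreover have "f (\<theta> + x) * torus_character n (- x) = torus_character n \<theta> * \<phi> n (x + \<theta>)" for x
      using torus_character_minus_shift[of n x \<theta>] by (simp add: \<phi>_def add.commute)
    then have "grid_coeff q f \<theta> n = torus_character n \<theta> * grid_mean q (\<lambda>x. \<phi> n (x + \<theta>))" for q
      by (simp only: grid_coeff_def grid_mean_cmult)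
    ultimately show ?thesis by (simp add: mult.commute)
  qed
  then show thesis by (rule that)
qed

lemma sum_circle_exp_symmetric:
  assumes "q = 2 * r + 1"
  shows "(\<Sum>m\<in>{- int r..int r}. circle_exp (of_int m * (of_int k / real q))) =
    (if int q dvd k then of_nat q else 0)"
proof -
  have "(\<Sum>m\<in>{- int r..int r}. circle_exp (of_int m * (of_int k / real q)))
      = (\<Sum>i<q. circle_exp (of_int (int i - int r) * (of_int k / real q)))"
    by (rule sum.reindex_bij_witness[of _ "\<lambda>i. int i - int r" "\<lambda>m. nat (m + int r)"]) (auto simp: assms)
  also have "\<dots> = (\<Sum>i<q. circle_exp (real i * (of_int k / real q)) *
      circle_exp (- (real r * (of_int k / real q))))"
    by (simp only: of_int_diff of_int_of_nat_eq left_diff_distrib circle_exp_diff)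
  also have "\<dots> = (if int q dvd k then of_nat q else 0) * circle_exp (- (real r * (of_int k / real q)))"
    unfolding sum_distrib_right[symmetric] using assms by (subst sum_circle_exp) auto
  also have "\<dots> = (if int q dvd k then of_nat q else 0)"
  proof (cases "int q dvd k")
    case True
    then obtain l where "k = int q * l" ..
    then have "- (real r * (of_int k / real q)) = of_int (- (int r * l))" using assms by simp
    then show ?thesis by (simp only: circle_exp_of_int mult_1_right)
  qed simp
  finally show ?thesis .
qed

lemma sum_torus_character_grid:
  fixes j :: "int ^ 'd"
  assumes q_odd: "q = 2 * r + 1" and j_mem: "j \<in> lattice_box {0..<int q}"
  shows "(\<Sum>n\<in>lattice_box {- int r..int r}. torus_character n (- (int_vec j /\<^sub>R real q))) =
    (if j = 0 then of_nat (q ^ CARD('d)) else 0)"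
proof -
  have "torus_character n (- (int_vec j /\<^sub>R real q))
      = (\<Prod>i\<in>UNIV. circle_exp (of_int (n $ i) * (of_int (- (j $ i)) / real q)))" for n
    by (simp add: torus_character_def inner_vec_def divide_inverse mult.commute
        flip: circle_exp_sum sum_negf)
  then have "(\<Sum>n\<in>lattice_box {- int r..int r}. torus_character n (- (int_vec j /\<^sub>R real q)))
      = (\<Prod>i\<in>UNIV. \<Sum>m\<in>{- int r..int r}. circle_exp (of_int m * (of_int (- (j $ i)) / real q)))"
    using sum_prod_lattice_box[of "{- int r..int r}"
        "\<lambda>i m. circle_exp (of_int m * (of_int (- (j $ i)) / real q))"]
    by (simp only: finite_atLeastAtMost_int simp_thms)
  also have "\<dots> = (\<Prod>i\<in>UNIV. if j $ i = 0 then of_nat q else 0)"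
  proof (rule prod.cong[OF refl])
    fix i
    have "0 \<le> j $ i" "j $ i < int q" using j_mem by (simp_all add: lattice_box_def)
    then have "int q dvd - (j $ i) \<longleftrightarrow> j $ i = 0"
      using zdvd_not_zless[of "j $ i" "int q"] by (cases "j $ i = 0") auto
    then show "(\<Sum>m\<in>{- int r..int r}. circle_exp (of_int m * (of_int (- (j $ i)) / real q))) =
        (if j $ i = 0 then of_nat q else 0)"
      by (simp only: sum_circle_exp_symmetric[OF q_odd])
  qed
  also have "\<dots> = (if j = 0 then of_nat (q ^ CARD('d)) else 0)"
    by (auto simp: vec_eq_iff prod_zero)
  finally show ?thesis .
qed

lemma sum_grid_coeff:
  fixes f :: "real ^ 'd \<Rightarrow> complex"
  assumes "q = 2 * r + 1"
  shows "(\<Sum>n\<in>lattice_box {- int r..int r}. grid_coeff q f \<theta> n) = f \<theta>"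
proof -
  let ?J = "lattice_box {0..<int q} :: (int ^ 'd) set"
  have "(\<Sum>n\<in>lattice_box {- int r..int r}. grid_coeff q f \<theta> n) = (\<Sum>j\<in>?J. f (\<theta> + int_vec j /\<^sub>R real q) *
      (\<Sum>n\<in>lattice_box {- int r..int r}. torus_character n (- (int_vec j /\<^sub>R real q))))
      /\<^sub>R real (q ^ CARD('d))"
    unfolding grid_coeff_def grid_mean_def scaleR_sum_right[symmetric] sum_distrib_left
    by (subst sum.swap) simp
  also have "\<dots> = (\<Sum>j\<in>?J. if j = 0 then f \<theta> * of_nat (q ^ CARD('d)) else 0) /\<^sub>R real (q ^ CARD('d))"
    by (intro arg_cong[of _ _ "\<lambda>y. y /\<^sub>R real (q ^ CARD('d))"] sum.cong)
      (auto simp: sum_torus_character_grid[OF assms])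
  also have "(\<Sum>j\<in>?J. if j = 0 then f \<theta> * of_nat (q ^ CARD('d)) else 0) = f \<theta> * of_nat (q ^ CARD('d))"
    using assms by (subst sum.delta[OF finite_lattice_box]) (auto simp: lattice_box_def)
  also have "(f \<theta> * of_nat (q ^ CARD('d))) /\<^sub>R real (q ^ CARD('d)) = f \<theta>"
    using assms by (simp add: scaleR_conv_of_real del: of_nat_power)
  finally show ?thesis .
qed

lemma grid_coeff_fdiff:
  assumes "q > 0" "torus_periodic f"
  shows "grid_coeff q (fdiff (int_vec s /\<^sub>R real q) f) \<theta> n =
    (torus_character n (int_vec s /\<^sub>R real q) - 1) * grid_coeff q f \<theta> n"
proof -
  let ?u = "int_vec s /\<^sub>R real q"
  define \<phi> where "\<phi> x = f (\<theta> + x) * torus_character n (- x)" for x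
  have "fdiff ?u f (\<theta> + x) * torus_character n (- x) = torus_character n ?u * \<phi> (x + ?u) - \<phi> x" for x
    using torus_character_minus_shift[of n x ?u]
    by (simp add: fdiff_def \<phi>_def left_diff_distrib add.assoc)
  moreover have "torus_periodic \<phi>"
    unfolding \<phi>_def[abs_def] by (intro torus_periodic_mult_character torus_periodic_translate assms(2))
  moreover have "grid_coeff q f \<theta> n = grid_mean q \<phi>" by (simp add: grid_coeff_def \<phi>_def[abs_def])
  ultimately show ?thesis
    using grid_mean_shift[OF assms(1), of \<phi> s]
    by (simp add: grid_coeff_def grid_mean_diff grid_mean_cmult left_diff_distrib)
qed

lemma grid_coeff_funpow_fdiff:
  assumes "q > 0" "torus_periodic f"
  shows "grid_coeff q ((fdiff (int_vec s /\<^sub>R real q) ^^ k) f) \<theta> n =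
    (torus_character n (int_vec s /\<^sub>R real q) - 1) ^ k * grid_coeff q f \<theta> n"
  by (induction k) (simp_all add: grid_coeff_fdiff[OF assms(1)] torus_periodic_funpow_fdiff assms(2))

lemma norm_grid_coeff_le:
  assumes "\<And>x. norm (f x) \<le> B"
  shows "norm (grid_coeff q f \<theta> n) \<le> B"
  unfolding grid_coeff_def by (rule norm_grid_mean_le) (simp add: norm_mult assms)

lemma norm_grid_coeff_component_le:
  fixes f :: "real ^ 'd \<Rightarrow> complex"
  assumes periodic: "torus_periodic f" and q_odd: "q = 2 * r + 1"
    and n_mem: "n \<in> lattice_box {- int r..int r}"
    and fdiff_le: "\<And>s x. norm ((fdiff (s *\<^sub>R axis i 1) ^^ k) f x) \<le> \<bar>s\<bar> ^ k * B"
  shows "norm (grid_coeff q f \<theta> n) * \<bar>of_int (n $ i)\<bar> ^ k \<le> B"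
proof -
  let ?u = "int_vec (axis i 1 :: int ^ 'd) /\<^sub>R real q"
  have u_eq: "?u = (1 / real q) *\<^sub>R axis i 1"
    by (simp add: vec_eq_iff axis_def inverse_eq_divide)
  have "\<bar>n $ i\<bar> \<le> int r" using n_mem by (auto simp: lattice_box_def abs_le_iff minus_le_iff)
  then have "\<bar>of_int (n $ i) / real q\<bar> < 1 / 2" using q_odd by (simp add: field_simps)
  then have "\<bar>of_int (n $ i)\<bar> / real q = infdist (of_int (n $ i) / real q) \<int>"
    using infdist_Ints_small by force
  also have "\<dots> \<le> norm (torus_character n ?u - 1)"
    using norm_circle_exp_minus_1_ge[of "of_int (n $ i) / real q"]
      infdist_nonneg[of "of_int (n $ i) / real q" \<int>]
    by (simp add: torus_character_def u_eq inner_axis)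
  finally have "(\<bar>of_int (n $ i)\<bar> / real q) ^ k * norm (grid_coeff q f \<theta> n)
      \<le> norm (torus_character n ?u - 1) ^ k * norm (grid_coeff q f \<theta> n)"
    by (intro mult_right_mono power_mono) auto
  also have "\<dots> = norm (grid_coeff q ((fdiff ?u ^^ k) f) \<theta> n)"
    using q_odd by (subst grid_coeff_funpow_fdiff[OF _ periodic]) (simp_all add: norm_mult norm_power)
  also have "\<dots> \<le> (1 / real q) ^ k * B"
    using fdiff_le[of "1 / real q"] unfolding u_eq by (intro norm_grid_coeff_le) simp
  finally show ?thesis using q_odd by (simp add: power_divide field_simps)
qed

lemma ex_norm_le_card_mult_component:
  fixes x :: "real ^ 'd"
  shows "\<exists>i. norm x \<le> real CARD('d) * \<bar>x $ i\<bar>"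
proof (rule ccontr)
  assume "\<nexists>i. norm x \<le> real CARD('d) * \<bar>x $ i\<bar>"
  then have "\<bar>x $ i\<bar> < norm x / real CARD('d)" for i
    by (simp add: field_simps not_le)
  then have "(\<Sum>i\<in>UNIV. \<bar>x $ i\<bar>) < (\<Sum>i\<in>(UNIV :: 'd set). norm x / real CARD('d))"
    by (intro sum_strict_mono) auto
  then show False using norm_le_l1_cart[of x] by simp
qed

lemma grid_coeff_decay:
  fixes f :: "real ^ 'd \<Rightarrow> complex"
  assumes periodic: "torus_periodic f" and smooth: "Cn_on k UNIV f"
  obtains B where "\<And>r \<theta> n. n \<in> lattice_box {- int r..int r} \<Longrightarrow>
    norm (grid_coeff (2 * r + 1) f \<theta> n) * freq_size n ^ k \<le> B"
proof -
  obtain B0 where f_le: "\<And>x. norm (f x) \<le> B0"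
    using torus_periodic_bounded[OF periodic Cn_on_imp_continuous_on[OF smooth]]
    by (auto simp: bounded_iff)
  have "\<exists>B. \<forall>s x. norm ((fdiff (s *\<^sub>R axis i 1) ^^ k) f x) \<le> \<bar>s\<bar> ^ k * B" for i :: 'd
    using torus_periodic_funpow_fdiff_bound[OF periodic smooth] by blast
  then obtain b where fdiff_le: "\<And>i s x. norm ((fdiff (s *\<^sub>R axis i 1) ^^ k) f x) \<le> \<bar>s\<bar> ^ k * b i"
    by metis
  define B where "B = real CARD('d) ^ k * (\<Sum>i\<in>UNIV. \<bar>b i\<bar>)"
  have "norm (grid_coeff (2 * r + 1) f \<theta> n) * freq_size n ^ k \<le> max B0 B"
    if n_mem: "n \<in> lattice_box {- int r..int r}" for r \<theta> n
  proof (cases "n = 0")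
    case True
    then show ?thesis using norm_grid_coeff_le[of f B0 "2 * r + 1" \<theta> 0, OF f_le] by simp
  next
    case False
    obtain i where size_le: "freq_size n \<le> real CARD('d) * \<bar>of_int (n $ i)\<bar>"
      using ex_norm_le_card_mult_component[of "int_vec n"] freq_size_eq_norm[OF False] by auto
    have "norm (grid_coeff (2 * r + 1) f \<theta> n) * freq_size n ^ k
        \<le> norm (grid_coeff (2 * r + 1) f \<theta> n) * (real CARD('d) * \<bar>of_int (n $ i)\<bar>) ^ k"
      using size_le less_imp_le[OF freq_size_pos] by (intro mult_left_mono power_mono) auto
    also have "\<dots> = real CARD('d) ^ k * (norm (grid_coeff (2 * r + 1) f \<theta> n) * \<bar>of_int (n $ i)\<bar> ^ k)"
      by (simp add: power_mult_distrib)
    also have "\<dots> \<le> real CARD('d) ^ k * b i"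
      by (rule mult_left_mono[OF norm_grid_coeff_component_le[OF periodic refl n_mem fdiff_le]]) simp
    also have "real CARD('d) ^ k * b i \<le> real CARD('d) ^ k * \<bar>b i\<bar>"
      by (intro mult_left_mono) auto
    also have "\<dots> \<le> B"
      unfolding B_def by (intro mult_left_mono member_le_sum) auto
    finally show ?thesis by simp
  qed
  then show thesis by (rule that)
qed

theorem fourier_series_Cn:
  fixes f :: "real ^ 'd \<Rightarrow> complex"
  assumes periodic: "torus_periodic f" and smooth: "Cn_on k UNIV f" and k_gt: "CARD('d) < k"
  obtains a B where "\<And>n. norm (a n) \<le> B * freq_size n powr - real k"
    and "\<And>\<theta>. ((\<lambda>n. a n * torus_character n \<theta>) has_sum f \<theta>) UNIV"
proof -
  obtain a where coeff_tendsto: "\<And>n \<theta>. (\<lambda>q. grid_coeff q f \<theta> n) \<longlonglongrightarrow> a n * torus_character n \<theta>"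
    using grid_coeff_tendsto[OF periodic Cn_on_imp_continuous_on[OF smooth]] by blast
  have coeff_odd_tendsto: "(\<lambda>r. grid_coeff (2 * r + 1) f \<theta> n) \<longlonglongrightarrow> a n * torus_character n \<theta>" for n \<theta>
    using LIMSEQ_subseq_LIMSEQ[OF coeff_tendsto, of "\<lambda>r. 2 * r + 1"]
    by (simp add: strict_mono_def o_def)
  obtain B where grid_decay: "\<And>r \<theta> n. n \<in> lattice_box {- int r..int r} \<Longrightarrow>
      norm (grid_coeff (2 * r + 1) f \<theta> n) * freq_size n ^ k \<le> B"
    using grid_coeff_decay[OF periodic smooth] by blast
  have decay: "norm (grid_coeff (2 * r + 1) f \<theta> n) \<le> B * freq_size n powr - real k"
    if "n \<in> lattice_box {- int r..int r}" for r \<theta> n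
    using grid_decay[OF that, of \<theta>] freq_size_pos[of n]
    by (simp add: powr_minus powr_realpow field_simps)
  have "((\<lambda>n. a n * torus_character n \<theta>) has_sum f \<theta>) UNIV" for \<theta>
  proof (rule has_sum_dominated_convergence)
    let ?g = "\<lambda>r n. if n \<in> lattice_box {- int r..int r} then grid_coeff (2 * r + 1) f \<theta> n else 0"
    show "(\<lambda>n :: int ^ 'd. \<bar>B\<bar> * freq_size n powr - real k) summable_on UNIV"
      using k_gt by (intro summable_on_cmult_right summable_on_freq_size_powr) simp
    show "norm (?g r n) \<le> \<bar>B\<bar> * freq_size n powr - real k" for r n
      using order_trans[OF decay[of n r \<theta>] mult_right_mono[OF abs_ge_self powr_ge_zero]] by simp
    show "(\<lambda>r. ?g r n) \<longlonglongrightarrow> a n * torus_character n \<theta>" for n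
      using coeff_odd_tendsto
      by (rule Lim_transform_eventually)
        (rule eventually_mono[OF eventually_mem_lattice_box[of n]], simp)
    show "(?g r has_sum f \<theta>) UNIV" for r
      by (rule has_sum_finite_neutralI[of "lattice_box {- int r..int r}"])
        (simp_all add: sum_grid_coeff)
  qed (rule tendsto_const)
  moreover have "norm (a n) \<le> B * freq_size n powr - real k" for n
  proof (rule tendsto_upperbound)
    show "(\<lambda>r. norm (grid_coeff (2 * r + 1) f 0 n)) \<longlonglongrightarrow> norm (a n)"
      using tendsto_norm[OF coeff_odd_tendsto[of 0 n]] by (simp add: norm_mult)
    show "\<forall>\<^sub>F r in sequentially. norm (grid_coeff (2 * r + 1) f 0 n) \<le> B * freq_size n powr - real k"
      using eventually_mem_lattice_box by (rule eventually_mono) (rule decay)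
  qed simp
  ultimately show thesis by (rule that[rotated])
qed

section \<open>Exponential sums with bump weights\<close>

lemma smooth_bump_Cn_on: "smooth_bump w \<Longrightarrow> Cn_on k UNIV w"
  by (simp add: smooth_bump_def Ck_on_def)

lemma smooth_bump_continuous: "smooth_bump w \<Longrightarrow> continuous_on UNIV w"
  by (rule Cn_on_imp_continuous_on[OF smooth_bump_Cn_on])

lemma smooth_bump_eq_0:
  assumes "smooth_bump w" "x \<notin> {0<..<1}"
  shows "w x = 0"
proof -
  have "closed {x. w x = 0}"
    using continuous_closed_preimage_constant[OF smooth_bump_continuous[OF assms(1)] closed_UNIV, of 0]
    by simp
  moreover have "{..<0} \<union> {1<..} \<subseteq> {x. w x = 0}"
    using assms(1) by (auto simp: smooth_bump_def)
  ultimately have "closure ({..<0} \<union> {1<..}) \<subseteq> {x. w x = 0}"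
    by (intro closure_minimal)
  with assms(2) show ?thesis by (auto simp: closure_Un subset_eq)
qed

lemma smooth_bump_nonneg: "smooth_bump w \<Longrightarrow> w x \<ge> 0"
  using smooth_bump_eq_0[of w x] by (cases "x \<in> {0<..<1}") (auto simp: smooth_bump_def less_imp_le)

lemma funpow_dir_deriv_eq_0_on_open:
  assumes "open S" "\<And>x. x \<in> S \<Longrightarrow> f x = 0" "x \<in> S"
  shows "(dir_deriv v ^^ k) f x = 0"
  using assms(3)
  by (induction k arbitrary: x) (auto simp: assms(2) intro: dir_deriv_eq_0_on_open[OF assms(1)])

lemma smooth_bump_funpow_fdiff_bound:
  assumes "smooth_bump w"
  obtains B where "B \<ge> 0" "\<And>s x. \<bar>(fdiff s ^^ k) w x\<bar> \<le> \<bar>s\<bar> ^ k * B"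
proof -
  let ?D = "(dir_deriv 1 ^^ k) w"
  have "continuous_on UNIV ?D"
    by (intro continuous_on_funpow_dir_deriv smooth_bump_Cn_on assms)
  then have "compact (?D ` {0..1})"
    by (intro compact_continuous_image) (auto intro: continuous_on_subset)
  moreover have "?D x = 0" if "x \<notin> {0..1}" for x
    by (rule funpow_dir_deriv_eq_0_on_open[of "- {0..1}"])
      (use that assms in \<open>auto simp: smooth_bump_def\<close>)
  then have "range ?D \<subseteq> insert 0 (?D ` {0..1})" by blast
  ultimately have "bounded (range ?D)"
    by (meson bounded_insert bounded_subset compact_imp_bounded)
  then obtain B where "B > 0" "\<And>x. norm (?D x) \<le> B" by (auto simp: bounded_pos)
  then show thesis
    using norm_funpow_fdiff_le[OF smooth_bump_Cn_on[OF assms], of k 1 B] by (intro that[of B]) auto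
qed

definition bump_sum :: "(real \<Rightarrow> real) \<Rightarrow> nat \<Rightarrow> real" where
  "bump_sum w N = (\<Sum>j<N. w (real (j + 1) / real (N + 1)))"

lemma bump_weight_eq: "bump_weight w N k = w (real (k + 1) / real (N + 1)) / bump_sum w N"
  by (simp add: bump_weight_def bump_sum_def inverse_eq_divide)

lemma bump_sum_ge:
  assumes "smooth_bump w"
  obtains d where "d > 0" "\<And>N. d * real N \<le> bump_sum w N"
proof -
  have "continuous_on {1/4..3/4} w" using smooth_bump_continuous[OF assms] continuous_on_subset by blast
  then obtain x\<^sub>0 where minimum: "x\<^sub>0 \<in> {1/4..3/4}" "\<And>y. y \<in> {1/4..3/4} \<Longrightarrow> w x\<^sub>0 \<le> w y"
    using continuous_attains_inf[of "{1/4..3/4 :: real}" w] by auto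
  have w_pos: "w x\<^sub>0 > 0" using minimum(1) assms by (auto simp: smooth_bump_def)
  have "w x\<^sub>0 / 2 * real N \<le> bump_sum w N" for N
  proof -
    let ?middle = "{N div 4..<N - N div 4}"
    have "real N \<le> 2 * real (card ?middle)" by simp
    then have "w x\<^sub>0 / 2 * real N \<le> (\<Sum>j\<in>?middle. w x\<^sub>0)"
      using mult_left_mono[of "real N" "2 * real (card ?middle)" "w x\<^sub>0 / 2"] w_pos
      by (simp add: mult.commute)
    also have "\<dots> \<le> (\<Sum>j\<in>?middle. w (real (j + 1) / real (N + 1)))"
    proof (rule sum_mono)
      fix j assume "j \<in> ?middle"
      then have "N + 1 \<le> 4 * (j + 1)" "4 * (j + 1) \<le> 3 * (N + 1)" by auto
      then have "real (N + 1) \<le> real (4 * (j + 1))" "real (4 * (j + 1)) \<le> real (3 * (N + 1))"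
        by (simp_all only: of_nat_le_iff)
      then show "w x\<^sub>0 \<le> w (real (j + 1) / real (N + 1))" by (intro minimum(2)) (auto simp: field_simps)
    qed
    also have "\<dots> \<le> bump_sum w N"
      unfolding bump_sum_def by (rule sum_mono2) (auto simp: smooth_bump_nonneg[OF assms])
    finally show ?thesis .
  qed
  then show thesis using w_pos by (intro that[of "w x\<^sub>0 / 2"]) auto
qed

lemma bump_sum_pos:
  assumes "smooth_bump w" "N \<ge> 1"
  shows "0 < bump_sum w N"
  unfolding bump_sum_def
  by (rule sum_pos) (use assms in \<open>auto simp: smooth_bump_def lessThan_empty_iff\<close>)

lemma bump_weight_pos:
  assumes "smooth_bump w" "k < N"
  shows "0 < bump_weight w N k"
  using assms bump_sum_pos[OF assms(1), of N] by (auto simp: bump_weight_eq smooth_bump_def)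

lemma sum_bump_weight:
  assumes "smooth_bump w" "N \<ge> 1"
  shows "(\<Sum>k<N. bump_weight w N k) = 1"
  unfolding bump_weight_eq sum_divide_distrib[symmetric] bump_sum_def[symmetric]
  using bump_sum_pos[OF assms] by simp

lemma sum_bump_weight_atMost: "smooth_bump w \<Longrightarrow> (\<Sum>k\<le>n. bump_weight w (n + 1) k) = 1"
  using sum_bump_weight[of w "n + 1"] by (simp add: lessThan_Suc_atMost)

definition bump_exp_sum :: "(real \<Rightarrow> real) \<Rightarrow> nat \<Rightarrow> real \<Rightarrow> complex" where
  "bump_exp_sum w N \<alpha> = (\<Sum>k<N. of_real (bump_weight w N k) * circle_exp (real k * \<alpha>))"

lemma bump_exp_sum_0: "smooth_bump w \<Longrightarrow> N \<ge> 1 \<Longrightarrow> bump_exp_sum w N 0 = 1"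
  using sum_bump_weight[of w N] by (simp add: bump_exp_sum_def flip: of_real_sum)

lemma has_sum_fdiff_circle_exp:
  fixes g :: "int \<Rightarrow> complex"
  assumes "((\<lambda>k. g k * circle_exp (of_int k * \<alpha>)) has_sum S) UNIV"
  shows "((\<lambda>k. fdiff 1 g k * circle_exp (of_int k * \<alpha>)) has_sum ((circle_exp (- \<alpha>) - 1) * S)) UNIV"
proof -
  have "bij (\<lambda>k::int. k + 1)" by (rule bij_betw_byWitness[where f' = "\<lambda>k. k - 1"]) auto
  then have "((\<lambda>k. g (k + 1) * circle_exp (of_int (k + 1) * \<alpha>)) has_sum S) UNIV"
    using assms by (subst has_sum_reindex_bij_betw[where f = "\<lambda>k. g k * circle_exp (of_int k * \<alpha>)"])
  then have "((\<lambda>k. circle_exp (- \<alpha>) * (g (k + 1) * circle_exp (of_int (k + 1) * \<alpha>)) +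
      - (g k * circle_exp (of_int k * \<alpha>))) has_sum (circle_exp (- \<alpha>) * S + - S)) UNIV"
    by (intro has_sum_add has_sum_cmult_right has_sum_uminusI assms)
  moreover have "circle_exp (of_int k * \<alpha>) = circle_exp (- \<alpha>) * circle_exp (of_int (k + 1) * \<alpha>)" for k
    by (simp add: algebra_simps flip: circle_exp_add)
  then have "fdiff 1 g k * circle_exp (of_int k * \<alpha>) =
      circle_exp (- \<alpha>) * (g (k + 1) * circle_exp (of_int (k + 1) * \<alpha>)) +
      - (g k * circle_exp (of_int k * \<alpha>))" for k
    by (simp add: fdiff_def left_diff_distrib)
  ultimately show ?thesis by (simp add: left_diff_distrib)
qed

lemma has_sum_funpow_fdiff_circle_exp:
  fixes g :: "int \<Rightarrow> complex"
  assumes "((\<lambda>k. g k * circle_exp (of_int k * \<alpha>)) has_sum S) UNIV"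
  shows "((\<lambda>k. (fdiff 1 ^^ m) g k * circle_exp (of_int k * \<alpha>))
      has_sum ((circle_exp (- \<alpha>) - 1) ^ m * S)) UNIV"
proof (induction m)
  case (Suc m)
  show ?case using has_sum_fdiff_circle_exp[OF Suc] by (simp add: mult.assoc)
qed (simp add: assms)

lemma funpow_fdiff_eq_0:
  fixes g :: "int \<Rightarrow> 'a::group_add"
  assumes "\<And>k. k \<notin> {a..b} \<Longrightarrow> g k = 0" "k \<notin> {a - int m..b}"
  shows "(fdiff 1 ^^ m) g k = 0"
  using assms(2) by (induction m arbitrary: k) (auto simp: assms(1) fdiff_def)

lemma funpow_fdiff_sample:
  fixes w :: "real \<Rightarrow> real"
  shows "(fdiff 1 ^^ m) (\<lambda>k::int. complex_of_real (w (of_int k * s))) k =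
      of_real ((fdiff s ^^ m) w (of_int k * s))"
  by (induction m arbitrary: k) (simp_all add: fdiff_def distrib_right)

lemma has_sum_bump_samples:
  assumes "smooth_bump w" "N \<ge> 1"
  shows "((\<lambda>k::int. of_real (w (of_int k * (1 / real (N + 1)))) * circle_exp (of_int k * \<alpha>)) has_sum
    (of_real (bump_sum w N) * circle_exp \<alpha> * bump_exp_sum w N \<alpha>)) UNIV"
proof (rule has_sum_finite_neutralI[of "{1..int N}"])
  fix k assume "k \<in> UNIV - {1..int N}"
  then have "of_int k * (1 / real (N + 1)) \<notin> {0<..<1}" by (auto simp: field_simps)
  from smooth_bump_eq_0[OF assms(1) this]
  show "of_real (w (of_int k * (1 / real (N + 1)))) * circle_exp (of_int k * \<alpha>) = 0" by simp
next
  have "of_real (bump_sum w N) * circle_exp \<alpha> *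
      (of_real (bump_weight w N k) * circle_exp (real k * \<alpha>)) =
      of_real (w (real (k + 1) / real (N + 1))) * circle_exp (real (k + 1) * \<alpha>)" for k
    using bump_sum_pos[OF assms] by (simp add: bump_weight_eq distrib_right circle_exp_add)
  then have "of_real (bump_sum w N) * circle_exp \<alpha> * bump_exp_sum w N \<alpha> =
      (\<Sum>k<N. of_real (w (real (k + 1) / real (N + 1))) * circle_exp (real (k + 1) * \<alpha>))"
    by (simp only: bump_exp_sum_def sum_distrib_left)
  also have "\<dots> = (\<Sum>k\<in>{1..int N}.
      of_real (w (of_int k * (1 / real (N + 1)))) * circle_exp (of_int k * \<alpha>))"
    by (rule sum.reindex_bij_witness[of _ "\<lambda>k. nat (k - 1)" "\<lambda>k. int k + 1"]) (auto simp: add.commute)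
  finally show "of_real (bump_sum w N) * circle_exp \<alpha> * bump_exp_sum w N \<alpha> =
      (\<Sum>k\<in>{1..int N}. of_real (w (of_int k * (1 / real (N + 1)))) * circle_exp (of_int k * \<alpha>))" .
qed auto

lemma norm_funpow_fdiff_bump_samples_le:
  assumes "smooth_bump w" "N \<ge> 1" and fdiff_le: "\<And>s x. \<bar>(fdiff s ^^ m) w x\<bar> \<le> \<bar>s\<bar> ^ m * B"
  shows "norm (circle_exp (- \<alpha>) - 1) ^ m * (bump_sum w N * norm (bump_exp_sum w N \<alpha>))
    \<le> real (N + m) * ((1 / real (N + 1)) ^ m * B)"
proof -
  define s where "s = 1 / real (N + 1)"
  define g where "g k = complex_of_real (w (of_int k * s))" for k :: int
  define S where "S = of_real (bump_sum w N) * circle_exp \<alpha> * bump_exp_sum w N \<alpha>"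
  have "g k = 0" if "k \<notin> {1..int N}" for k
    using that smooth_bump_eq_0[OF assms(1), of "of_int k * s"] by (auto simp: g_def s_def field_simps)
  then have "(fdiff 1 ^^ m) g k = 0" if "k \<notin> {1 - int m..int N}" for k
    using that by (rule funpow_fdiff_eq_0)
  then have "((\<lambda>k. (fdiff 1 ^^ m) g k * circle_exp (of_int k * \<alpha>)) has_sum
      (\<Sum>k\<in>{1 - int m..int N}. (fdiff 1 ^^ m) g k * circle_exp (of_int k * \<alpha>))) UNIV"
    by (intro has_sum_finite_neutralI[of "{1 - int m..int N}"]) auto
  moreover have "((\<lambda>k. (fdiff 1 ^^ m) g k * circle_exp (of_int k * \<alpha>)) has_sum
      ((circle_exp (- \<alpha>) - 1) ^ m * S)) UNIV"
    using has_sum_bump_samples[OF assms(1,2)] unfolding S_def g_def s_def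
    by (rule has_sum_funpow_fdiff_circle_exp)
  ultimately have "(circle_exp (- \<alpha>) - 1) ^ m * S =
      (\<Sum>k\<in>{1 - int m..int N}. (fdiff 1 ^^ m) g k * circle_exp (of_int k * \<alpha>))"
    by (rule has_sum_unique[rotated])
  also have "norm \<dots> \<le> of_nat (card {1 - int m..int N}) * (s ^ m * B)"
  proof (rule sum_norm_bound)
    fix k show "norm ((fdiff 1 ^^ m) g k * circle_exp (of_int k * \<alpha>)) \<le> s ^ m * B"
      using fdiff_le[of s "of_int k * s"] unfolding g_def funpow_fdiff_sample
      by (simp add: norm_mult s_def)
  qed
  finally show ?thesis
    using bump_sum_pos[OF assms(1,2)]
    by (simp add: S_def s_def norm_mult norm_power abs_of_pos add.commute)
qed

lemma bump_exp_sum_decay: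
  assumes "smooth_bump w"
  obtains C where "C \<ge> 0" "\<And>N \<alpha>. N \<ge> 1 \<Longrightarrow> norm (bump_exp_sum w N \<alpha>) * (real N * infdist \<alpha> \<int>) ^ m \<le> C"
proof -
  obtain B where fdiff_le: "B \<ge> 0" "\<And>s x. \<bar>(fdiff s ^^ m) w x\<bar> \<le> \<bar>s\<bar> ^ m * B"
    using smooth_bump_funpow_fdiff_bound[OF assms] by metis
  obtain d where sum_ge: "d > 0" "\<And>N. d * real N \<le> bump_sum w N"
    using bump_sum_ge[OF assms] by metis
  have "norm (bump_exp_sum w N \<alpha>) * (real N * infdist \<alpha> \<int>) ^ m \<le> real (m + 1) * B / d"
    if N_ge: "N \<ge> 1" for N \<alpha>
  proof -
    let ?S = "norm (bump_exp_sum w N \<alpha>)"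
    have "infdist (- \<alpha>) \<int> = infdist \<alpha> \<int>" by (rule infdist_Ints_minus)
    then have "infdist \<alpha> \<int> \<le> norm (circle_exp (- \<alpha>) - 1)"
      using norm_circle_exp_minus_1_ge[of "- \<alpha>"] infdist_nonneg[of \<alpha> \<int>] by simp
    then have "infdist \<alpha> \<int> ^ m * (d * real N * ?S) \<le> norm (circle_exp (- \<alpha>) - 1) ^ m *
        (bump_sum w N * ?S)"
      using sum_ge infdist_nonneg[of \<alpha> \<int>] by (intro mult_mono power_mono mult_right_mono) auto
    also have "\<dots> \<le> real (N + m) * ((1 / real (N + 1)) ^ m * B)"
      by (rule norm_funpow_fdiff_bump_samples_le[OF assms N_ge fdiff_le(2)])
    also have "\<dots> \<le> (real (m + 1) * real N) * ((1 / real N) ^ m * B)"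
    proof (intro mult_mono power_mono)
      have "m * 1 \<le> m * N" using N_ge by (intro mult_le_mono2)
      then show "real (N + m) \<le> real (m + 1) * real N"
        by (simp add: algebra_simps flip: of_nat_mult of_nat_add)
    qed (use fdiff_le(1) N_ge in \<open>auto simp: field_simps\<close>)
    finally have "real N * (d * (infdist \<alpha> \<int> ^ m * ?S)) \<le> real N * (real (m + 1) * B / real N ^ m)"
      by (simp add: power_divide mult_ac)
    then have "d * (infdist \<alpha> \<int> ^ m * ?S) \<le> real (m + 1) * B / real N ^ m"
      by (rule mult_left_le_imp_le) (use N_ge in simp)
    then show ?thesis using sum_ge(1) N_ge by (simp add: power_mult_distrib field_simps)
  qed
  then show thesis using fdiff_le(1) sum_ge(1) by (intro that[of "real (m + 1) * B / d"]) auto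
qed

lemma bump_exp_sum_decay_scaled:
  assumes "smooth_bump w" "q \<ge> 0"
  obtains C where "C \<ge> 0" "\<And>N \<alpha> \<delta>. N \<ge> 1 \<Longrightarrow> 0 \<le> \<delta> \<Longrightarrow> \<delta> \<le> q * infdist \<alpha> \<int> \<Longrightarrow>
    norm (bump_exp_sum w N \<alpha>) * (real N * \<delta>) ^ m \<le> C"
proof -
  obtain C where decay: "C \<ge> 0"
      "\<And>N \<alpha>. N \<ge> 1 \<Longrightarrow> norm (bump_exp_sum w N \<alpha>) * (real N * infdist \<alpha> \<int>) ^ m \<le> C"
    using bump_exp_sum_decay[OF assms(1)] by metis
  have "norm (bump_exp_sum w N \<alpha>) * (real N * \<delta>) ^ m \<le> q ^ m * C"
    if "N \<ge> 1" "0 \<le> \<delta>" "\<delta> \<le> q * infdist \<alpha> \<int>" for N \<alpha> \<delta>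
  proof -
    have "real N * \<delta> \<le> q * (real N * infdist \<alpha> \<int>)"
      using mult_left_mono[OF that(3), of "real N"] by (simp add: mult_ac)
    then have "norm (bump_exp_sum w N \<alpha>) * (real N * \<delta>) ^ m
        \<le> norm (bump_exp_sum w N \<alpha>) * (q * (real N * infdist \<alpha> \<int>)) ^ m"
      using that(2) by (intro mult_left_mono power_mono) auto
    also have "\<dots> = q ^ m * (norm (bump_exp_sum w N \<alpha>) * (real N * infdist \<alpha> \<int>) ^ m)"
      by (simp only: power_mult_distrib mult_ac)
    also have "\<dots> \<le> q ^ m * C" using assms(2) by (intro mult_left_mono decay(2)[OF that(1)]) simp
    finally show ?thesis .
  qed
  then show thesis using decay(1) assms(2) by (intro that[of "q ^ m * C"]) auto
qed

section \<open>Weighted averages along residue classes\<close>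

text \<open>The contribution of the visits to island \<open>s\<close> of an orbit started on island \<open>j\<close>, islands being
  numbered from 0.\<close>

definition residue_average ::
    "(real \<Rightarrow> real) \<Rightarrow> nat \<Rightarrow> nat \<Rightarrow> nat \<Rightarrow> nat \<Rightarrow> (nat \<Rightarrow> 'v::real_vector) \<Rightarrow> 'v" where
  "residue_average w N p j s g =
    (\<Sum>k<N. if (k + j) mod p = s then bump_weight w N k *\<^sub>R g ((k + j) div p) else 0)"

lemma residue_average_linear:
  assumes "linear T"
  shows "residue_average w N p j s (\<lambda>l. T (g l)) = T (residue_average w N p j s g)"
  unfolding residue_average_def linear_sum[OF assms]
  by (intro sum.cong) (simp_all add: linear_cmul[OF assms] linear_0[OF assms])

lemma has_sum_sum:
  fixes f :: "'i \<Rightarrow> 'a \<Rightarrow> 'b::topological_comm_monoid_add"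
  assumes "\<And>i. i \<in> I \<Longrightarrow> (f i has_sum S i) A"
  shows "((\<lambda>x. \<Sum>i\<in>I. f i x) has_sum (\<Sum>i\<in>I. S i)) A"
  using assms by (induction I rule: infinite_finite_induct) (auto intro: has_sum_add)

lemma norm_has_sum_diff_le:
  fixes f g :: "'a \<Rightarrow> 'b::real_normed_vector"
  assumes "(f has_sum S) A" "(g has_sum T) A" "(h has_sum U) A" "\<And>x. x \<in> A \<Longrightarrow> norm (f x - g x) \<le> h x"
  shows "norm (S - T) \<le> U"
proof -
  have "((\<lambda>x. f x + - g x) has_sum (S + - T)) A"
    by (intro has_sum_add[OF assms(1)]) (simp add: has_sum_uminus assms(2))
  then show ?thesis using norm_infsum_le[OF _ assms(3)] assms(4) by fastforce
qed

lemma has_sum_residue_average: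
  fixes g :: "'n \<Rightarrow> nat \<Rightarrow> 'v::real_normed_vector"
  assumes "\<And>l. ((\<lambda>n. g n l) has_sum G l) A"
  shows "((\<lambda>n. residue_average w N p j s (g n)) has_sum residue_average w N p j s G) A"
  unfolding residue_average_def
proof (rule has_sum_sum)
  fix k
  show "((\<lambda>n. if (k + j) mod p = s then bump_weight w N k *\<^sub>R g n ((k + j) div p) else 0) has_sum
      (if (k + j) mod p = s then bump_weight w N k *\<^sub>R G ((k + j) div p) else 0)) A"
    using has_sum_scaleR[OF assms] by simp
qed

lemma sum_circle_exp_residue:
  assumes "s < p"
  shows "(\<Sum>r<p. circle_exp ((\<beta> + real r) * ((real k - real s) / real p))) =
    (if k mod p = s then of_nat p * circle_exp (\<beta> * real (k div p)) else 0)"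
proof -
  have "(\<beta> + real r) * ((real k - real s) / real p) =
      \<beta> * ((real k - real s) / real p) + real r * (of_int (int k - int s) / real p)" for r
    by (simp add: distrib_right add_divide_distrib)
  then have "(\<Sum>r<p. circle_exp ((\<beta> + real r) * ((real k - real s) / real p))) =
      circle_exp (\<beta> * ((real k - real s) / real p)) * (if int p dvd int k - int s then of_nat p else 0)"
    using assms sum_circle_exp[of p "int k - int s"]
    by (simp only: circle_exp_add sum_distrib_left[symmetric])
  moreover have "int p dvd int k - int s \<longleftrightarrow> k mod p = s"
    using assms by (simp flip: mod_eq_dvd_iff zmod_int)
  moreover have "(real k - real s) / real p = real (k div p)" if "k mod p = s"
  proof -
    have "real k = real (k div p * p + k mod p)" by simp
    then show ?thesis using that assms by (simp add: field_simps)
  qed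
  ultimately show ?thesis
    by (cases "k mod p = s")
      (simp_all only: simp_thms if_True if_False mult_zero_left mult_zero_right mult.commute)
qed

lemma residue_average_circle_exp:
  assumes "s < p"
  shows "residue_average w N p j s (\<lambda>l. circle_exp (\<beta> * real l)) =
    (\<Sum>r<p. circle_exp ((\<beta> + real r) * ((real j - real s) / real p)) *
      bump_exp_sum w N ((\<beta> + real r) / real p))
      / of_nat p"
proof -
  have split: "circle_exp ((\<beta> + real r) * ((real (k + j) - real s) / real p)) =
      circle_exp ((\<beta> + real r) * ((real j - real s) / real p)) *
      circle_exp (real k * ((\<beta> + real r) / real p))" for k r
    by (simp add: algebra_simps add_divide_distrib diff_divide_distrib flip: circle_exp_add)
  have "(if (k + j) mod p = s then bump_weight w N k *\<^sub>R circle_exp (\<beta> * real ((k + j) div p)) else 0) =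
      of_real (bump_weight w N k) *
      (\<Sum>r<p. circle_exp ((\<beta> + real r) * ((real (k + j) - real s) / real p))) / of_nat p" for k
    using assms by (simp only: sum_circle_exp_residue[OF assms]) (simp add: scaleR_conv_of_real)
  then have "residue_average w N p j s (\<lambda>l. circle_exp (\<beta> * real l)) =
      (\<Sum>k<N. \<Sum>r<p. circle_exp ((\<beta> + real r) * ((real j - real s) / real p)) *
        (of_real (bump_weight w N k) * circle_exp (real k * ((\<beta> + real r) / real p)))) / of_nat p"
    unfolding residue_average_def split sum_distrib_left
    by (simp add: sum_divide_distrib mult.left_commute)
  also have "(\<Sum>k<N. \<Sum>r<p. circle_exp ((\<beta> + real r) * ((real j - real s) / real p)) *
        (of_real (bump_weight w N k) * circle_exp (real k * ((\<beta> + real r) / real p)))) =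
      (\<Sum>r<p. circle_exp ((\<beta> + real r) * ((real j - real s) / real p)) *
        bump_exp_sum w N ((\<beta> + real r) / real p))"
    unfolding bump_exp_sum_def sum_distrib_left by (rule sum.swap)
  finally show ?thesis .
qed

lemma norm_sum_divide_le:
  fixes f :: "nat \<Rightarrow> complex"
  assumes "R \<subseteq> {..<p}" "0 \<le> B" "0 \<le> X" and f_le: "\<And>r. r \<in> R \<Longrightarrow> norm (f r) * X \<le> B"
  shows "norm ((\<Sum>r\<in>R. f r) / of_nat p) * X \<le> B"
proof (cases "p = 0")
  case False
  have "norm (\<Sum>r\<in>R. f r) * X \<le> (\<Sum>r\<in>R. norm (f r)) * X"
    using assms(3) by (intro mult_right_mono norm_sum)
  also have "\<dots> \<le> (\<Sum>r\<in>R. B)"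
    unfolding sum_distrib_right by (intro sum_mono f_le)
  also have "\<dots> \<le> real p * B"
    using card_mono[OF _ assms(1)] assms(2) by (simp add: mult_right_mono)
  finally show ?thesis using False by (simp add: norm_divide field_simps)
qed (use assms(2) in simp)

lemma residue_average_circle_exp_decay:
  assumes "smooth_bump w"
  obtains C where "C \<ge> 0" "\<And>N j s \<beta>. N \<ge> 1 \<Longrightarrow> s < p \<Longrightarrow>
    norm (residue_average w N p j s (\<lambda>l. circle_exp (\<beta> * real l))) * (real N * infdist \<beta> \<int>) ^ m \<le> C"
proof -
  obtain C where decay: "C \<ge> 0" "\<And>N \<alpha> \<delta>. N \<ge> 1 \<Longrightarrow> 0 \<le> \<delta> \<Longrightarrow> \<delta> \<le> real p * infdist \<alpha> \<int> \<Longrightarrow>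
      norm (bump_exp_sum w N \<alpha>) * (real N * \<delta>) ^ m \<le> C"
    using bump_exp_sum_decay_scaled[OF assms, of "real p"] by (metis of_nat_0_le_iff)
  have "norm (residue_average w N p j s (\<lambda>l. circle_exp (\<beta> * real l))) * (real N * infdist \<beta> \<int>) ^ m \<le> C"
    if N_ge: "N \<ge> 1" and s_less: "s < p" for N j s \<beta>
    unfolding residue_average_circle_exp[OF s_less]
  proof (rule norm_sum_divide_le)
    fix r
    have "infdist \<beta> \<int> \<le> real p * infdist ((\<beta> + real r) / real p) \<int>"
      using infdist_Ints_divide[of p "\<beta> + real r"] s_less
      by (simp add: infdist_Ints_add_of_nat field_simps)
    then show "norm (circle_exp ((\<beta> + real r) * ((real j - real s) / real p)) *
        bump_exp_sum w N ((\<beta> + real r) / real p)) * (real N * infdist \<beta> \<int>) ^ m \<le> C"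
      using decay(2)[OF N_ge infdist_nonneg] by (simp add: norm_mult)
  qed (auto simp: decay(1) infdist_nonneg)
  then show thesis using that decay(1) by blast
qed

lemma residue_average_one_convergence:
  assumes "smooth_bump w"
  obtains C where "C \<ge> 0" "\<And>N j s. N \<ge> 1 \<Longrightarrow> s < p \<Longrightarrow>
    norm (residue_average w N p j s (\<lambda>l. 1) - 1 / of_nat p :: complex) * real N ^ m \<le> C"
proof -
  obtain C where decay: "C \<ge> 0" "\<And>N \<alpha> \<delta>. N \<ge> 1 \<Longrightarrow> 0 \<le> \<delta> \<Longrightarrow> \<delta> \<le> real p * infdist \<alpha> \<int> \<Longrightarrow>
      norm (bump_exp_sum w N \<alpha>) * (real N * \<delta>) ^ m \<le> C"
    using bump_exp_sum_decay_scaled[OF assms, of "real p"] by (metis of_nat_0_le_iff)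
  have "norm (residue_average w N p j s (\<lambda>l. 1) - 1 / of_nat p :: complex) * real N ^ m \<le> C"
    if N_ge: "N \<ge> 1" and s_less: "s < p" for N j s
  proof -
    let ?f = "\<lambda>r. circle_exp (real r * ((real j - real s) / real p)) *
        bump_exp_sum w N (real r / real p)"
    have "residue_average w N p j s (\<lambda>l. 1) = (\<Sum>r<p. ?f r) / of_nat p"
      using residue_average_circle_exp[OF s_less, of w N j 0] by simp
    also have "(\<Sum>r<p. ?f r) = 1 + (\<Sum>r\<in>{..<p} - {0}. ?f r)"
      using s_less by (subst sum.remove[of _ 0]) (auto simp: bump_exp_sum_0[OF assms N_ge])
    finally have "residue_average w N p j s (\<lambda>l. 1) - 1 / of_nat p = (\<Sum>r\<in>{..<p} - {0}. ?f r) / of_nat p"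
      by (simp add: add_divide_distrib)
    moreover have "norm ((\<Sum>r\<in>{..<p} - {0}. ?f r) / of_nat p) * real N ^ m \<le> C"
    proof (rule norm_sum_divide_le)
      fix r assume "r \<in> {..<p} - {0}"
      then have "1 \<le> real p * infdist (real r / real p) \<int>"
        using infdist_Ints_fraction_ge[of p r] by (auto simp: field_simps nat_dvd_not_less)
      from decay(2)[OF N_ge _ this] show "norm (?f r) * real N ^ m \<le> C" by (simp add: norm_mult)
    qed (auto simp: decay(1))
    ultimately show ?thesis by simp
  qed
  then show thesis using that decay(1) by blast
qed

section \<open>Rotation modes and the Diophantine condition\<close>

lemma diophantine_infdist:
  assumes "diophantine c \<nu> \<omega>" "n \<noteq> 0"
  shows "c * freq_size n powr - \<nu> \<le> infdist (\<omega> \<bullet> int_vec n) \<int>"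
  using assms by (intro le_infdist_Ints) (simp add: diophantine_def freq_size_eq_norm)

lemma diophantine_nonneg:
  fixes \<omega> :: "real ^ 'd"
  assumes "diophantine c \<nu> \<omega>"
  shows "\<nu> \<ge> 0"
proof (rule ccontr)
  assume "\<not> \<nu> \<ge> 0"
  have "c > 0" using assms by (simp add: diophantine_def)
  have bounded: "c * real (Suc t) powr - \<nu> \<le> 1 / 2" for t
  proof -
    let ?n = "axis undefined (int (Suc t)) :: int ^ 'd"
    have int_vec_axis: "int_vec ?n = real (Suc t) *\<^sub>R axis undefined 1" by (auto simp: vec_eq_iff axis_def)
    have "?n \<noteq> 0" by (simp add: axis_eq_0_iff)
    then have "freq_size ?n = norm (int_vec ?n)" by (rule freq_size_eq_norm)
    also have "\<dots> = real (Suc t)" unfolding int_vec_axis by simp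
    finally show ?thesis
      using diophantine_infdist[OF assms \<open>?n \<noteq> 0\<close>] infdist_Ints_le_half order_trans by metis
  qed
  have "filterlim (\<lambda>t. c * real (Suc t) powr - \<nu>) at_top sequentially"
    using \<open>c > 0\<close> \<open>\<not> \<nu> \<ge> 0\<close>
    by (intro filterlim_tendsto_pos_mult_at_top[OF tendsto_const]
          filterlim_compose[OF real_powr_at_top]
          filterlim_compose[OF filterlim_real_sequentially filterlim_Suc]) auto
  then have "\<forall>\<^sub>F t in sequentially. c * real (Suc t) powr - \<nu> > 1 / 2"
    unfolding filterlim_at_top_dense by blast
  then show False using bounded eventually_happens'[OF sequentially_bot] by (metis not_le)
qed

lemma has_sum_residue_average_rotation:
  assumes "\<And>\<theta>. ((\<lambda>n. a n * torus_character n \<theta>) has_sum f \<theta>) UNIV"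
  shows "((\<lambda>n. a n * torus_character n \<theta> *
      residue_average w N p j s (\<lambda>l. torus_character n (real l *\<^sub>R \<omega>)))
    has_sum residue_average w N p j s (\<lambda>l. f (\<theta> + real l *\<^sub>R \<omega>))) UNIV"
proof -
  have "a n * torus_character n \<theta> * residue_average w N p j s (\<lambda>l. torus_character n (real l *\<^sub>R \<omega>)) =
      residue_average w N p j s (\<lambda>l. a n * torus_character n (\<theta> + real l *\<^sub>R \<omega>))" for n
    by (subst residue_average_linear[symmetric, OF bounded_linear.linear[OF bounded_linear_mult_right]])
      (simp add: torus_character_add mult.assoc)
  then show ?thesis by (simp only:) (rule has_sum_residue_average, rule assms)
qed

lemma residue_average_rotation_mode:
  assumes bump: "smooth_bump w" and dioph: "diophantine c \<nu> \<omega>"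
  obtains C where "C \<ge> 0" "\<And>N j s n. N \<ge> 1 \<Longrightarrow> s < p \<Longrightarrow>
    norm (residue_average w N p j s (\<lambda>l. torus_character n (real l *\<^sub>R \<omega>))
        - (if n = 0 then 1 / of_nat p else 0))
      \<le> C / real N ^ m * freq_size n powr (real m * \<nu>)"
proof -
  obtain C\<^sub>0 where mean_close: "C\<^sub>0 \<ge> 0" "\<And>N j s. N \<ge> 1 \<Longrightarrow> s < p \<Longrightarrow>
      norm (residue_average w N p j s (\<lambda>l. 1) - 1 / of_nat p :: complex) * real N ^ m \<le> C\<^sub>0"
    using residue_average_one_convergence[OF bump] by metis
  obtain C\<^sub>1 where mode_decay: "C\<^sub>1 \<ge> 0" "\<And>N j s \<beta>. N \<ge> 1 \<Longrightarrow> s < p \<Longrightarrow>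
      norm (residue_average w N p j s (\<lambda>l. circle_exp (\<beta> * real l))) * (real N * infdist \<beta> \<int>) ^ m \<le> C\<^sub>1"
    using residue_average_circle_exp_decay[OF bump] by metis
  have c_pos: "c > 0" using dioph by (simp add: diophantine_def)
  define C where "C = max C\<^sub>0 (C\<^sub>1 / c ^ m)"
  have "norm (residue_average w N p j s (\<lambda>l. torus_character n (real l *\<^sub>R \<omega>))
        - (if n = 0 then 1 / of_nat p else 0))
      \<le> C / real N ^ m * freq_size n powr (real m * \<nu>)" if N_ge: "N \<ge> 1" and s_less: "s < p" for N j s n
  proof (cases "n = 0")
    case True
    have "norm (residue_average w N p j s (\<lambda>l. 1) - 1 / of_nat p :: complex) * real N ^ m \<le> C"
      using mean_close(2)[OF N_ge s_less, of j] by (simp add: C_def)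
    then show ?thesis using True N_ge by (simp add: field_simps)
  next
    case False
    let ?R = "norm (residue_average w N p j s (\<lambda>l. torus_character n (real l *\<^sub>R \<omega>)))"
    have "?R * (real N * (c * freq_size n powr - \<nu>)) ^ m
        \<le> ?R * (real N * infdist (\<omega> \<bullet> int_vec n) \<int>) ^ m"
      using diophantine_infdist[OF dioph False] c_pos by (intro mult_left_mono power_mono) auto
    also have "\<dots> \<le> C\<^sub>1" unfolding torus_character_multiple by (rule mode_decay(2)[OF N_ge s_less])
    also have "C\<^sub>1 \<le> C * c ^ m" using c_pos by (simp add: C_def flip: pos_divide_le_eq)
    finally have "?R * (real N ^ m * (c ^ m * (freq_size n powr - \<nu>) ^ m)) \<le> C * c ^ m"
      by (simp only: power_mult_distrib)
    moreover have "(freq_size n powr - \<nu>) ^ m = inverse (freq_size n powr (real m * \<nu>))"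
      using freq_size_pos[of n]
      by (simp add: powr_minus[symmetric] powr_powr mult.commute flip: powr_realpow)
    ultimately show ?thesis using False N_ge c_pos freq_size_pos[of n] by (simp add: field_simps)
  qed
  moreover have "C \<ge> 0" using mean_close(1) by (simp add: C_def)
  ultimately show thesis using that by blast
qed

lemma norm_residue_average_fourier_le:
  fixes f :: "real ^ 'd \<Rightarrow> complex"
  assumes series: "\<And>\<theta>. ((\<lambda>n. a n * torus_character n \<theta>) has_sum f \<theta>) UNIV"
    and coeff_le: "\<And>n. norm (a n) \<le> B * freq_size n powr - \<kappa>"
    and mode_close: "\<And>n. norm (residue_average w N p j s (\<lambda>l. torus_character n (real l *\<^sub>R \<omega>))
        - (if n = 0 then 1 / of_nat p else 0)) \<le> E * freq_size n powr \<rho>"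
    and S_sum: "((\<lambda>n :: int ^ 'd. freq_size n powr (\<rho> - \<kappa>)) has_sum S) UNIV"
  shows "norm (residue_average w N p j s (\<lambda>l. f (\<theta> + real l *\<^sub>R \<omega>)) - a 0 / of_nat p) \<le> B * E * S"
proof -
  define R where "R n = residue_average w N p j s (\<lambda>l. torus_character n (real l *\<^sub>R \<omega>))" for n
  define \<delta> where "\<delta> n = (if n = 0 then 1 / complex_of_nat p else 0)" for n :: "int ^ 'd"
  have "((\<lambda>n. a n * torus_character n \<theta> * R n) has_sum
      residue_average w N p j s (\<lambda>l. f (\<theta> + real l *\<^sub>R \<omega>))) UNIV"
    unfolding R_def by (rule has_sum_residue_average_rotation[OF series])
  moreover have "((\<lambda>n. a n * torus_character n \<theta> * \<delta> n) has_sum (a 0 / of_nat p)) UNIV"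
    by (rule has_sum_finite_neutralI[of "{0}"]) (auto simp: \<delta>_def)
  moreover have "((\<lambda>n :: int ^ 'd. B * E * freq_size n powr (\<rho> - \<kappa>)) has_sum (B * E * S)) UNIV"
    by (rule has_sum_cmult_right[OF S_sum])
  moreover have "norm (a n * torus_character n \<theta> * R n - a n * torus_character n \<theta> * \<delta> n)
      \<le> B * E * freq_size n powr (\<rho> - \<kappa>)" for n
  proof -
    have "norm (a n * torus_character n \<theta> * R n - a n * torus_character n \<theta> * \<delta> n) =
        norm (a n) * norm (R n - \<delta> n)"
      by (simp add: norm_mult flip: right_diff_distrib)
    also have "\<dots> \<le> (B * freq_size n powr - \<kappa>) * (E * freq_size n powr \<rho>)"
      unfolding R_def \<delta>_def
      by (intro mult_mono coeff_le mode_close order_trans[OF norm_ge_zero coeff_le]) auto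
    also have "\<dots> = B * E * freq_size n powr (\<rho> - \<kappa>)"
      by (simp add: powr_add[symmetric] mult_ac)
    finally show ?thesis .
  qed
  ultimately show ?thesis by (rule norm_has_sum_diff_le)
qed

lemma residue_average_rotation_complex:
  fixes f :: "real ^ 'd \<Rightarrow> complex"
  assumes bump: "smooth_bump w" and dioph: "diophantine c \<nu> \<omega>"
    and periodic: "torus_periodic f" and smooth: "Cn_on k UNIV f"
    and k_large: "real CARD('d) + real m * \<nu> < real k"
  obtains C L where "\<And>N j s \<theta>. N \<ge> 1 \<Longrightarrow> s < p \<Longrightarrow>
    norm (residue_average w N p j s (\<lambda>l. f (\<theta> + real l *\<^sub>R \<omega>)) - L) \<le> C / real N ^ m"
proof -
  have "0 \<le> real m * \<nu>" using diophantine_nonneg[OF dioph] by simp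
  then have "CARD('d) < k" using k_large by linarith
  then obtain a B where coeff_le: "\<And>n. norm (a n) \<le> B * freq_size n powr - real k"
    and series: "\<And>\<theta>. ((\<lambda>n. a n * torus_character n \<theta>) has_sum f \<theta>) UNIV"
    using fourier_series_Cn[OF periodic smooth] by blast
  obtain C where mode_close: "C \<ge> 0" "\<And>N j s n. N \<ge> 1 \<Longrightarrow> s < p \<Longrightarrow>
      norm (residue_average w N p j s (\<lambda>l. torus_character n (real l *\<^sub>R \<omega>))
          - (if n = 0 then 1 / of_nat p else 0))
        \<le> C / real N ^ m * freq_size n powr (real m * \<nu>)"
    using residue_average_rotation_mode[OF bump dioph, of p m] by blast
  have "(\<lambda>n :: int ^ 'd. freq_size n powr (real m * \<nu> - real k)) summable_on UNIV"
    using k_large summable_on_freq_size_powr[where 'd = 'd, of "real k - real m * \<nu>"] by simp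
  then obtain S where S_sum: "((\<lambda>n :: int ^ 'd. freq_size n powr (real m * \<nu> - real k)) has_sum S) UNIV"
    by (auto simp: summable_on_def)
  have "norm (residue_average w N p j s (\<lambda>l. f (\<theta> + real l *\<^sub>R \<omega>)) - a 0 / of_nat p)
      \<le> B * C * S / real N ^ m"
    if N_ge: "N \<ge> 1" and s_less: "s < p" for N j s \<theta>
    using norm_residue_average_fourier_le[OF series coeff_le mode_close(2)[OF N_ge s_less] S_sum] by simp
  then show thesis by (rule that)
qed

lemma residue_average_rotation:
  fixes f :: "real ^ 'd \<Rightarrow> 'v::euclidean_space"
  assumes bump: "smooth_bump w" and dioph: "diophantine c \<nu> \<omega>"
    and periodic: "torus_periodic f" and smooth: "Cn_on k UNIV f"
    and k_large: "real CARD('d) + real m * \<nu> < real k"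
  obtains C L where "\<And>N j s \<theta>. N \<ge> 1 \<Longrightarrow> s < p \<Longrightarrow>
    norm (residue_average w N p j s (\<lambda>l. f (\<theta> + real l *\<^sub>R \<omega>)) - L) \<le> C / real N ^ m"
proof -
  define T where "T b v = complex_of_real (v \<bullet> b)" for b v :: 'v
  have T_linear: "bounded_linear (T b)" for b
    unfolding T_def[abs_def]
    by (intro bounded_linear_compose[OF bounded_linear_of_real bounded_linear_inner_left])
  have "\<exists>C L. \<forall>N\<ge>1. \<forall>j \<theta>. \<forall>s<p.
      norm (T b (residue_average w N p j s (\<lambda>l. f (\<theta> + real l *\<^sub>R \<omega>))) - L) \<le> C / real N ^ m" for b
  proof -
    have periodic_T: "torus_periodic (\<lambda>\<theta>. T b (f \<theta>))" using periodic by (simp add: torus_periodic_def)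
    have smooth_T: "Cn_on k UNIV (\<lambda>\<theta>. T b (f \<theta>))"
      by (rule Cn_on_bounded_linear[OF open_UNIV T_linear smooth])
    obtain C L where "\<And>N j s \<theta>. N \<ge> 1 \<Longrightarrow> s < p \<Longrightarrow>
        norm (residue_average w N p j s (\<lambda>l. T b (f (\<theta> + real l *\<^sub>R \<omega>))) - L) \<le> C / real N ^ m"
      by (rule residue_average_rotation_complex[OF bump dioph periodic_T smooth_T k_large, where p = p])
        blast
    then show ?thesis unfolding residue_average_linear[OF bounded_linear.linear[OF T_linear]] by blast
  qed
  then obtain C L where component_rate: "\<And>b N j s \<theta>. N \<ge> 1 \<Longrightarrow> s < p \<Longrightarrow>
      norm (T b (residue_average w N p j s (\<lambda>l. f (\<theta> + real l *\<^sub>R \<omega>))) - L b) \<le> C b / real N ^ m"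
    by metis
  define L' where "L' = (\<Sum>b\<in>Basis. Re (L b) *\<^sub>R b)"
  have "norm (v - L') \<le> (\<Sum>b\<in>Basis. C b) / real N ^ m"
    if "N \<ge> 1" "s < p" "v = residue_average w N p j s (\<lambda>l. f (\<theta> + real l *\<^sub>R \<omega>))" for N j s \<theta> v
  proof -
    have "norm (v - L') \<le> (\<Sum>b\<in>Basis. \<bar>(v - L') \<bullet> b\<bar>)" by (rule norm_le_l1)
    also have "\<dots> \<le> (\<Sum>b\<in>Basis. C b / real N ^ m)"
    proof (rule sum_mono)
      fix b :: 'v assume "b \<in> Basis"
      then have "(v - L') \<bullet> b = Re (T b v - L b)"
        by (simp add: L'_def T_def inner_diff_left)
      also have "\<bar>\<dots>\<bar> \<le> norm (T b v - L b)" by (rule abs_Re_le_cmod)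
      also have "\<dots> \<le> C b / real N ^ m" unfolding that(3) by (rule component_rate[OF that(1,2)])
      finally show "\<bar>(v - L') \<bullet> b\<bar> \<le> C b / real N ^ m" .
    qed
    finally show ?thesis by (simp add: sum_divide_distrib)
  qed
  then show thesis using that by blast
qed

section \<open>The weighted Birkhoff average on islands\<close>

lemma island_orbit:
  assumes island: "island_dynamics M X A F X\<^sub>0 \<omega> \<mu> p z"
  shows "(F ^^ k) (z 1 \<theta>) = z (Suc (k mod p)) (\<theta> + real (k div p) *\<^sub>R \<omega>)"
proof (induction k)
  case 0
  then show ?case by simp
next
  case (Suc k)
  have p_ge: "p \<ge> 1" and step: "\<And>j \<theta>. j \<in> {1..<p} \<Longrightarrow> F (z j \<theta>) = z (j + 1) \<theta>"
    and last: "\<And>\<theta>. F (z p \<theta>) = z 1 (\<theta> + \<omega>)"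
    using island by (auto simp: island_dynamics_def)
  show ?case
  proof (cases "Suc (k mod p) = p")
    case True
    then have "Suc k mod p = 0" "Suc k div p = Suc (k div p)" by (simp_all add: mod_Suc div_Suc)
    with True Suc last show ?thesis by (simp add: algebra_simps)
  next
    case False
    then have "Suc k mod p = Suc (k mod p)" "Suc k div p = k div p" by (simp_all add: mod_Suc div_Suc)
    moreover have "k mod p < p" using p_ge by simp
    with False have "Suc (k mod p) \<in> {1..<p}" by auto
    ultimately show ?thesis using Suc step by simp
  qed
qed

lemma island_orbit_from:
  assumes island: "island_dynamics M X A F X\<^sub>0 \<omega> \<mu> p z" and "x \<in> X\<^sub>0"
  obtains j \<theta> where "\<And>k. (F ^^ k) x = z (Suc ((k + j) mod p)) (\<theta> + real ((k + j) div p) *\<^sub>R \<omega>)"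
proof -
  obtain i \<theta> where "i \<in> {1..p}" "x = z i \<theta>"
    using assms by (auto simp: island_dynamics_def)
  then have "x = (F ^^ (i - 1)) (z 1 \<theta>)"
    unfolding island_orbit[OF island] by (cases i) auto
  then have "(F ^^ k) x = (F ^^ (k + (i - 1))) (z 1 \<theta>)" for k
    by (simp only: funpow_add o_apply)
  then show thesis by (intro that) (simp only: island_orbit[OF island])
qed

lemma island_forward_invariant:
  assumes island: "island_dynamics M X A F X\<^sub>0 \<omega> \<mu> p z" and "x \<in> X\<^sub>0"
  shows "(F ^^ k) x \<in> X\<^sub>0"
proof -
  obtain j \<theta> where "(F ^^ k) x = z (Suc ((k + j) mod p)) (\<theta> + real ((k + j) div p) *\<^sub>R \<omega>)"
    using island_orbit_from[OF assms] by metis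
  moreover have "Suc ((k + j) mod p) \<in> {1..p}"
    using island by (simp add: island_dynamics_def Suc_le_eq)
  ultimately show ?thesis using island unfolding island_dynamics_def by blast
qed

lemma WB_island:
  assumes island: "island_dynamics M X A F X\<^sub>0 \<omega> \<mu> p z" and "x \<in> X\<^sub>0"
  obtains j \<theta> where "\<And>N. WB w F N h x =
    (\<Sum>s<p. residue_average w N p j s (\<lambda>l. h (z (Suc s) (\<theta> + real l *\<^sub>R \<omega>))))"
proof -
  obtain j \<theta> where orbit: "\<And>k. (F ^^ k) x = z (Suc ((k + j) mod p)) (\<theta> + real ((k + j) div p) *\<^sub>R \<omega>)"
    using island_orbit_from[OF assms] by metis
  have "p \<ge> 1" using island by (simp add: island_dynamics_def)
  then have "bump_weight w N k *\<^sub>R h ((F ^^ k) x) = (\<Sum>s<p. if (k + j) mod p = s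
      then bump_weight w N k *\<^sub>R h (z (Suc s) (\<theta> + real ((k + j) div p) *\<^sub>R \<omega>)) else 0)" for N k
    by (simp add: orbit)
  then have "WB w F N h x =
      (\<Sum>s<p. residue_average w N p j s (\<lambda>l. h (z (Suc s) (\<theta> + real l *\<^sub>R \<omega>))))" for N
    unfolding WB_def residue_average_def by (simp only:) (rule sum.swap)
  then show thesis by (rule that)
qed

lemma ex_nat_between_real_enat:
  assumes "ereal x < ereal_of_enat M"
  obtains k where "enat k \<le> M" "x < real k"
proof (cases M)
  case (enat k)
  then show ?thesis using assms by (intro that[of k]) auto
next
  case infinity
  obtain k where "x < real k" using reals_Archimedean2 by blast
  then show ?thesis using infinity by (intro that[of k]) auto
qed

lemma WB_convergence_rate:
  fixes X :: "'x topology" and A :: "('x, 'e::euclidean_space) chart set"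
    and z :: "nat \<Rightarrow> real ^ 'd \<Rightarrow> 'x" and h :: "'x \<Rightarrow> 'v::euclidean_space"
  assumes bump: "smooth_bump w" and dioph: "diophantine c \<nu> \<omega>"
    and manifold: "Ck_manifold M X A" and island: "island_dynamics M X A F X\<^sub>0 \<omega> \<mu> p z"
    and h_Ck: "Ck_map M X A euclidean std_atlas h"
    and M_large: "ereal_of_enat M > ereal (real CARD('d) + real m * \<nu>)"
  obtains C L where "\<And>N x. N \<ge> 1 \<Longrightarrow> x \<in> X\<^sub>0 \<Longrightarrow> norm (WB w F N h x - L) \<le> C / real N ^ m"
proof -
  obtain k where k_large: "enat k \<le> M" "real CARD('d) + real m * \<nu> < real k"
    using ex_nat_between_real_enat[OF M_large] .
  define rate where "rate s C L \<longleftrightarrow> (\<forall>N\<ge>1. \<forall>j \<theta>.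
      norm (residue_average w N p j s (\<lambda>l. h (z (Suc s) (\<theta> + real l *\<^sub>R \<omega>))) - L)
        \<le> C / real N ^ m)" for s C L
  have "\<exists>C L. rate s C L" if "s < p" for s
  proof -
    have z_Ck: "torus_Ck_map M X A (z (Suc s))" using island that by (auto simp: island_dynamics_def)
    have periodic: "torus_periodic (\<lambda>\<theta>. h (z (Suc s) \<theta>))"
      using z_Ck by (simp add: torus_periodic_def torus_Ck_map_def)
    have smooth: "Cn_on k UNIV (\<lambda>\<theta>. h (z (Suc s) \<theta>))"
      using z_Ck
      by (intro Cn_on_compose_Ck_maps[OF manifold h_Ck _ k_large(1)]) (simp add: torus_Ck_map_def)
    obtain C L where "\<And>N j r \<theta>. N \<ge> 1 \<Longrightarrow> r < p \<Longrightarrow>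
        norm (residue_average w N p j r (\<lambda>l. h (z (Suc s) (\<theta> + real l *\<^sub>R \<omega>))) - L) \<le> C / real N ^ m"
      by (rule residue_average_rotation[OF bump dioph periodic smooth k_large(2), where p = p]) blast
    then have "rate s C L" unfolding rate_def using that by blast
    then show ?thesis by blast
  qed
  then obtain C L where residue_rate: "\<And>s. s < p \<Longrightarrow> rate s (C s) (L s)" by metis
  have "norm (WB w F N h x - (\<Sum>s<p. L s)) \<le> (\<Sum>s<p. C s) / real N ^ m"
    if N_ge: "N \<ge> 1" and x_mem: "x \<in> X\<^sub>0" for N x
  proof -
    obtain j \<theta> where "WB w F N h x =
        (\<Sum>s<p. residue_average w N p j s (\<lambda>l. h (z (Suc s) (\<theta> + real l *\<^sub>R \<omega>))))"
      by (rule WB_island[OF island x_mem, where w = w and h = h]) blast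
    then have "WB w F N h x - (\<Sum>s<p. L s) =
        (\<Sum>s<p. residue_average w N p j s (\<lambda>l. h (z (Suc s) (\<theta> + real l *\<^sub>R \<omega>))) - L s)"
      by (simp add: sum_subtractf)
    also have "norm \<dots> \<le> (\<Sum>s<p. C s / real N ^ m)"
      by (rule sum_norm_le) (use residue_rate N_ge in \<open>simp add: rate_def\<close>)
    finally show ?thesis by (simp add: sum_divide_distrib)
  qed
  then show thesis by (rule that)
qed

lemma space_borel_of [simp]: "space (borel_of X) = topspace X"
  and openin_sets_borel_of: "openin X U \<Longrightarrow> U \<in> sets (borel_of X)"
proof -
  have "{U. openin X U} \<subseteq> Pow (topspace X)" using openin_subset by blast
  then show "space (borel_of X) = topspace X" "openin X U \<Longrightarrow> U \<in> sets (borel_of X)"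
    by (auto simp: borel_of_def space_measure_of sets_measure_of)
qed

lemma borel_of_euclidean: "borel_of euclidean = borel"
  by (simp add: borel_of_def borel_def)

lemma continuous_map_imp_measurable:
  assumes "continuous_map X Y f"
  shows "f \<in> borel_of X \<rightarrow>\<^sub>M borel_of Y"
  unfolding borel_of_def[of Y]
proof (rule measurable_measure_of)
  show "{U. openin Y U} \<subseteq> Pow (topspace Y)" using openin_subset by blast
  show "f \<in> space (borel_of X) \<rightarrow> topspace Y" using assms by (auto simp: continuous_map_def)
  show "f -` U \<inter> space (borel_of X) \<in> sets (borel_of X)" if "U \<in> {U. openin Y U}" for U
  proof -
    have "openin X {x \<in> topspace X. f x \<in> U}" using that assms by (simp add: continuous_map_def)
    moreover have "f -` U \<inter> space (borel_of X) = {x \<in> topspace X. f x \<in> U}" by auto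
    ultimately show ?thesis by (simp add: openin_sets_borel_of)
  qed
qed

lemma distr_funpow:
  assumes F_invariant: "F \<in> \<mu> \<rightarrow>\<^sub>M \<mu>" "distr \<mu> \<mu> F = \<mu>"
  shows "distr \<mu> \<mu> (F ^^ k) = \<mu>"
proof (induction k)
  case 0
  then show ?case by (simp add: id_def distr_id)
next
  case (Suc k)
  have "distr \<mu> \<mu> (F \<circ> (F ^^ k)) = distr (distr \<mu> \<mu> (F ^^ k)) \<mu> F"
    using F_invariant(1) by (intro distr_distr[symmetric] measurable_compose_n) auto
  then show ?case by (simp only: funpow.simps Suc F_invariant(2))
qed

lemma integral_WB_invariant:
  fixes g :: "'x \<Rightarrow> 'v::{banach, second_countable_topology}"
  assumes F_invariant: "F \<in> \<mu> \<rightarrow>\<^sub>M \<mu>" "distr \<mu> \<mu> F = \<mu>" and g_integrable: "integrable \<mu> g"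
    and bump: "smooth_bump w" "N \<ge> 1"
  shows "integrable \<mu> (WB w F N g)" and "integral\<^sup>L \<mu> (WB w F N g) = integral\<^sup>L \<mu> g"
proof -
  have funpow_measurable: "F ^^ k \<in> \<mu> \<rightarrow>\<^sub>M \<mu>" for k using F_invariant(1) by (rule measurable_compose_n)
  have integrable_funpow: "integrable \<mu> (\<lambda>x. g ((F ^^ k) x))" for k
    using integrable_distr[OF funpow_measurable[of k]] g_integrable
    by (simp add: distr_funpow[OF F_invariant])
  have "(\<integral>x. g ((F ^^ k) x) \<partial>\<mu>) = integral\<^sup>L \<mu> g" for k
    using integral_distr[OF funpow_measurable[of k] borel_measurable_integrable[OF g_integrable]]
    by (simp add: distr_funpow[OF F_invariant])
  then show "integrable \<mu> (WB w F N g)" "integral\<^sup>L \<mu> (WB w F N g) = integral\<^sup>L \<mu> g"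
    using integrable_funpow sum_bump_weight[OF bump]
    by (simp_all add: WB_def[abs_def] flip: scaleR_sum_left)
qed

lemma (in prob_space) norm_integral_diff_le:
  fixes G :: "'a \<Rightarrow> 'v::{banach, second_countable_topology}"
  assumes "integrable M G" "AE x in M. norm (G x - L) \<le> C"
  shows "norm (integral\<^sup>L M G - L) \<le> C"
proof -
  have "integral\<^sup>L M G - L = (\<integral>x. G x - L \<partial>M)" using assms(1) by (simp add: prob_space)
  also have "norm \<dots> \<le> (\<integral>x. norm (G x - L) \<partial>M)" by (rule integral_norm_bound)
  also have "\<dots> \<le> (\<integral>x. C \<partial>M)" using assms by (intro integral_mono_AE) auto
  finally show ?thesis by (simp add: prob_space)
qed

lemma WB_limit_close_to_set_integral:
  fixes h :: "'x \<Rightarrow> 'v::euclidean_space"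
  assumes invariant: "invariant_prob X F X\<^sub>0 \<mu>" and F_continuous: "continuous_map X X F"
    and h_continuous: "continuous_map X euclidean h"
    and orbit: "\<And>k x. x \<in> X\<^sub>0 \<Longrightarrow> (F ^^ k) x \<in> X\<^sub>0" and h_bounded: "bounded (h ` X\<^sub>0)"
    and bump: "smooth_bump w" "N \<ge> 1" and close: "\<And>x. x \<in> X\<^sub>0 \<Longrightarrow> norm (WB w F N h x - L) \<le> C"
  shows "norm ((LINT y:X\<^sub>0|\<mu>. h y) - L) \<le> C"
proof -
  have sets [measurable_cong]: "sets \<mu> = sets (borel_of X)" and "emeasure \<mu> (space \<mu>) = 1"
    and X\<^sub>0_full: "emeasure \<mu> X\<^sub>0 = 1" and distr: "distr \<mu> \<mu> F = \<mu>"
    using invariant by (auto simp: invariant_prob_def)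
  interpret prob_space \<mu> by (rule prob_spaceI) fact
  have X\<^sub>0_sets: "X\<^sub>0 \<in> sets \<mu>" using X\<^sub>0_full emeasure_neq_0_sets by force
  have F_meas: "F \<in> \<mu> \<rightarrow>\<^sub>M \<mu>"
    using continuous_map_imp_measurable[OF F_continuous]
    by (simp add: measurable_cong_sets[OF sets sets])
  have h_meas: "h \<in> borel_measurable \<mu>"
    using continuous_map_imp_measurable[OF h_continuous]
    by (simp add: borel_of_euclidean measurable_cong_sets[OF sets refl])
  define g where "g x = indicator X\<^sub>0 x *\<^sub>R h x" for x
  obtain B where "B > 0" "\<And>x. x \<in> X\<^sub>0 \<Longrightarrow> norm (h x) \<le> B" using h_bounded by (auto simp: bounded_pos)
  then have "norm (g x) \<le> B" for x by (simp add: g_def indicator_def)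
  then have g_integrable: "integrable \<mu> g"
    using X\<^sub>0_sets h_meas by (intro integrable_const_bound[of g B]) (auto simp: g_def[abs_def])
  have "AE x in \<mu>. x \<in> X\<^sub>0"
    using AE_in_set_eq_1[OF X\<^sub>0_sets] X\<^sub>0_full by (simp add: measure_def)
  moreover have "norm (WB w F N g x - L) \<le> C" if "x \<in> X\<^sub>0" for x
    using close[OF that] orbit[OF that] by (simp add: WB_def g_def)
  ultimately have "AE x in \<mu>. norm (WB w F N g x - L) \<le> C" by auto
  then have "norm (integral\<^sup>L \<mu> g - L) \<le> C"
    using norm_integral_diff_le integral_WB_invariant[OF F_meas distr g_integrable bump] by metis
  then show ?thesis by (simp add: g_def[abs_def] set_lebesgue_integral_def)
qed

lemma island_observable_bounded:
  fixes X :: "'x topology" and A :: "('x, 'e::euclidean_space) chart set"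
    and z :: "nat \<Rightarrow> real ^ 'd \<Rightarrow> 'x" and h :: "'x \<Rightarrow> 'v::euclidean_space"
  assumes manifold: "Ck_manifold M X A" and island: "island_dynamics M X A F X\<^sub>0 \<omega> \<mu> p z"
    and h_Ck: "Ck_map M X A euclidean std_atlas h"
  shows "bounded (h ` X\<^sub>0)"
proof -
  have "bounded (range (\<lambda>\<theta>. h (z j \<theta>)))" if "j \<in> {1..p}" for j
  proof (rule torus_periodic_bounded)
    have z_Ck: "torus_Ck_map M X A (z j)" using island that by (auto simp: island_dynamics_def)
    then have "Cn_on 0 UNIV (\<lambda>\<theta>. h (z j \<theta>))"
      by (intro Cn_on_compose_Ck_maps[OF manifold h_Ck])
        (auto simp: torus_Ck_map_def zero_enat_def[symmetric])
    then show "continuous_on UNIV (\<lambda>\<theta>. h (z j \<theta>))" by simp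
    show "torus_periodic (\<lambda>\<theta>. h (z j \<theta>))" using z_Ck by (simp add: torus_Ck_map_def torus_periodic_def)
  qed
  then have "bounded (\<Union>j\<in>{1..p}. range (\<lambda>\<theta>. h (z j \<theta>)))" by (intro bounded_UN) auto
  moreover have "h ` X\<^sub>0 = (\<Union>j\<in>{1..p}. range (\<lambda>\<theta>. h (z j \<theta>)))"
    using island by (auto simp: island_dynamics_def)
  ultimately show ?thesis by (simp only:)
qed

theorem weighted_birkhoff_average:
  fixes X :: "'x topology" and A :: "('x, 'e::euclidean_space) chart set"
    and z :: "nat \<Rightarrow> real ^ 'd \<Rightarrow> 'x" and h :: "'x \<Rightarrow> 'v::euclidean_space"
  assumes bump: "smooth_bump w" and dioph: "diophantine c \<nu> \<omega>"
    and manifold: "Ck_manifold M X A" and F_Ck: "Ck_map M X A X A F"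
    and island: "island_dynamics M X A F X\<^sub>0 \<omega> \<mu> p z"
    and h_Ck: "Ck_map M X A euclidean std_atlas h"
    and M_large: "ereal_of_enat M > ereal (real CARD('d) + real m * \<nu>)"
  shows "\<exists>C. \<forall>N\<ge>1. \<forall>x\<in>X\<^sub>0. norm (WB w F N h x - (LINT y:X\<^sub>0|\<mu>. h y)) \<le> C / real N ^ m"
proof -
  obtain C L where rate: "\<And>N x. N \<ge> 1 \<Longrightarrow> x \<in> X\<^sub>0 \<Longrightarrow> norm (WB w F N h x - L) \<le> C / real N ^ m"
    by (rule WB_convergence_rate[OF bump dioph manifold island h_Ck M_large]) blast
  have "norm (WB w F N h x - (LINT y:X\<^sub>0|\<mu>. h y)) \<le> (2 * C) / real N ^ m"
    if N_ge: "N \<ge> 1" and x_mem: "x \<in> X\<^sub>0" for N x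
  proof -
    have "invariant_prob X F X\<^sub>0 \<mu>" "continuous_map X X F" "continuous_map X euclidean h"
      using island F_Ck h_Ck unfolding island_dynamics_def Ck_map_def by blast+
    then have "norm ((LINT y:X\<^sub>0|\<mu>. h y) - L) \<le> C / real N ^ m"
      by (rule WB_limit_close_to_set_integral[OF _ _ _ island_forward_invariant[OF island]
            island_observable_bounded[OF manifold island h_Ck] bump N_ge rate[OF N_ge]])
    then show ?thesis
      using rate[OF N_ge x_mem] norm_triangle_ineq4[of "WB w F N h x - L" "(LINT y:X\<^sub>0|\<mu>. h y) - L"]
      by simp
  qed
  then show ?thesis by blast
qed

section \<open>Linear least squares\<close>

lemma ex_orthogonal_translate:
  fixes a b :: "'r \<Rightarrow> real"
  assumes "finite R"
  shows "\<exists>t. (\<Sum>r\<in>R. (b r + t * a r) * a r) = 0"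
proof -
  have expand: "(\<Sum>r\<in>R. (b r + t * a r) * a r) = (\<Sum>r\<in>R. b r * a r) + t * (\<Sum>r\<in>R. a r * a r)" for t
    by (simp add: distrib_right sum.distrib sum_distrib_left mult.assoc)
  show ?thesis
  proof (cases "(\<Sum>r\<in>R. a r * a r) = 0")
    case True
    then have "\<forall>r\<in>R. a r = 0" using assms by (simp add: sum_nonneg_eq_0_iff)
    then show ?thesis by simp
  next
    case False
    then show ?thesis
      unfolding expand by (intro exI[of _ "- (\<Sum>r\<in>R. b r * a r) / (\<Sum>r\<in>R. a r * a r)"]) simp
  qed
qed

text \<open>Orthogonalizing one column at a time requires no rank assumption.\<close>

lemma normal_equations_solvable:
  fixes b :: "'r \<Rightarrow> real" and A :: "'k \<Rightarrow> 'r \<Rightarrow> real"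
  assumes "finite J" "finite R"
  shows "\<exists>y. \<forall>k\<in>J. (\<Sum>r\<in>R. (b r + (\<Sum>j\<in>J. y j * A j r)) * A k r) = 0"
  using assms(1)
proof (induction J arbitrary: b)
  case (insert i J)
  obtain y where b_orth: "\<And>k. k \<in> J \<Longrightarrow> (\<Sum>r\<in>R. (b r + (\<Sum>j\<in>J. y j * A j r)) * A k r) = 0"
    using insert.IH by blast
  obtain z where A_orth: "\<And>k. k \<in> J \<Longrightarrow> (\<Sum>r\<in>R. (A i r + (\<Sum>j\<in>J. z j * A j r)) * A k r) = 0"
    using insert.IH by blast
  define b' where "b' r = b r + (\<Sum>j\<in>J. y j * A j r)" for r
  define a where "a r = A i r + (\<Sum>j\<in>J. z j * A j r)" for r
  obtain t where t_orth: "(\<Sum>r\<in>R. (b' r + t * a r) * a r) = 0"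
    using ex_orthogonal_translate[OF assms(2)] by blast
  have orth_J: "(\<Sum>r\<in>R. (b' r + t * a r) * A k r) = 0" if "k \<in> J" for k
  proof -
    have "(\<Sum>r\<in>R. (b' r + t * a r) * A k r) = (\<Sum>r\<in>R. b' r * A k r) + t * (\<Sum>r\<in>R. a r * A k r)"
      by (simp add: distrib_right sum.distrib sum_distrib_left mult.assoc)
    then show ?thesis using b_orth[OF that] A_orth[OF that] by (simp add: b'_def a_def)
  qed
  have "A i r = a r - (\<Sum>j\<in>J. z j * A j r)" for r by (simp add: a_def)
  then have "(\<Sum>r\<in>R. (b' r + t * a r) * A i r) =
      (\<Sum>r\<in>R. (b' r + t * a r) * a r) - (\<Sum>r\<in>R. \<Sum>j\<in>J. z j * ((b' r + t * a r) * A j r))"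
    by (simp add: right_diff_distrib sum_subtractf sum_distrib_left mult.left_commute)
  also have "(\<Sum>r\<in>R. \<Sum>j\<in>J. z j * ((b' r + t * a r) * A j r)) = 0"
    by (subst sum.swap) (simp add: orth_J flip: sum_distrib_left)
  finally have orth_i: "(\<Sum>r\<in>R. (b' r + t * a r) * A i r) = 0" using t_orth by simp
  define x where "x j = (if j = i then t else y j + t * z j)" for j
  have "(\<Sum>j\<in>J. x j * A j r) = (\<Sum>j\<in>J. y j * A j r) + t * (\<Sum>j\<in>J. z j * A j r)" for r
    unfolding sum_distrib_left sum.distrib[symmetric]
    by (rule sum.cong) (use insert.hyps in \<open>auto simp: x_def distrib_right\<close>)
  then have "b r + (\<Sum>j\<in>insert i J. x j * A j r) = b' r + t * a r" for r
    using insert.hyps by (simp add: b'_def a_def x_def distrib_left)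
  then show ?case using orth_J orth_i by (intro exI[of _ x]) auto
qed simp

lemma least_squares_attained:
  fixes b :: "'r \<Rightarrow> real" and A :: "'k \<Rightarrow> 'r \<Rightarrow> real"
  assumes "finite J" "finite R"
  shows "\<exists>y. \<forall>y'. (\<Sum>r\<in>R. (b r + (\<Sum>k\<in>J. y k * A k r))\<^sup>2) \<le> (\<Sum>r\<in>R. (b r + (\<Sum>k\<in>J. y' k * A k r))\<^sup>2)"
proof -
  obtain y where y_normal: "\<And>k. k \<in> J \<Longrightarrow> (\<Sum>r\<in>R. (b r + (\<Sum>j\<in>J. y j * A j r)) * A k r) = 0"
    using normal_equations_solvable[OF assms] by blast
  define u where "u r = b r + (\<Sum>j\<in>J. y j * A j r)" for r
  have "(\<Sum>r\<in>R. (u r)\<^sup>2) \<le> (\<Sum>r\<in>R. (b r + (\<Sum>k\<in>J. y' k * A k r))\<^sup>2)" for y'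
  proof -
    define d where "d r = (\<Sum>k\<in>J. (y' k - y k) * A k r)" for r
    have "(\<Sum>r\<in>R. u r * d r) = (\<Sum>k\<in>J. (y' k - y k) * (\<Sum>r\<in>R. u r * A k r))"
      unfolding d_def sum_distrib_left by (subst sum.swap) (simp add: mult.left_commute)
    also have "\<dots> = 0" using y_normal by (simp add: u_def)
    finally have "(\<Sum>r\<in>R. (u r + d r)\<^sup>2) = (\<Sum>r\<in>R. (u r)\<^sup>2) + (\<Sum>r\<in>R. (d r)\<^sup>2)"
      by (simp add: power2_sum sum.distrib mult.assoc flip: sum_distrib_left)
    moreover have "b r + (\<Sum>k\<in>J. y' k * A k r) = u r + d r" for r
      by (simp add: u_def d_def left_diff_distrib sum_subtractf)
    ultimately show ?thesis by (simp add: sum_nonneg)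
  qed
  then show ?thesis unfolding u_def by blast
qed

lemma sum_squared_le_sum_divide_weights:
  fixes c v :: "'k \<Rightarrow> real"
  assumes "\<And>k. k \<in> I \<Longrightarrow> v k > 0"
  shows "(\<Sum>k\<in>I. c k)\<^sup>2 \<le> (\<Sum>k\<in>I. (c k)\<^sup>2 / v k) * (\<Sum>k\<in>I. v k)"
proof -
  have "(\<Sum>k\<in>I. c k) = (\<Sum>k\<in>I. c k / sqrt (v k) * sqrt (v k))"
    using assms by (intro sum.cong) force+
  also have "\<dots>\<^sup>2 \<le> (\<Sum>k\<in>I. (c k / sqrt (v k))\<^sup>2) * (\<Sum>k\<in>I. (sqrt (v k))\<^sup>2)"
    by (rule Cauchy_Schwarz_ineq_sum)
  also have "\<dots> = (\<Sum>k\<in>I. (c k)\<^sup>2 / v k) * (\<Sum>k\<in>I. v k)"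
    using assms by (intro arg_cong2[of _ _ _ _ "(*)"] sum.cong) (auto simp: power_divide less_imp_le)
  finally show ?thesis .
qed

section \<open>The Birkhoff RRE residual\<close>

definition rre_coeffs :: "nat \<Rightarrow> (nat \<Rightarrow> real) \<Rightarrow> nat \<Rightarrow> real" where
  "rre_coeffs K y k =
    (if k = K then 1 - 2 * (\<Sum>j\<in>{1..K}. y j) else if k < K then y (K - k) else y (k - K))"

lemma sum_symmetric_about:
  fixes g :: "nat \<Rightarrow> 'a::comm_monoid_add"
  shows "(\<Sum>k\<le>2 * K. g k) = g K + (\<Sum>j\<in>{1..K}. g (K + j) + g (K - j))"
proof -
  have "{..2 * K} = insert K ({..<K} \<union> {K<..2 * K})" by auto
  moreover have "{..<K} \<inter> {K<..2 * K} = {}" by auto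
  ultimately have "(\<Sum>k\<le>2 * K. g k) = g K + (sum g {..<K} + sum g {K<..2 * K})"
    by (simp add: sum.union_disjoint)
  moreover have "sum g {K<..2 * K} = (\<Sum>j\<in>{1..K}. g (K + j))"
    by (rule sum.reindex_bij_witness[of _ "\<lambda>j. K + j" "\<lambda>k. k - K"]) auto
  moreover have "sum g {..<K} = (\<Sum>j\<in>{1..K}. g (K - j))"
    by (rule sum.reindex_bij_witness[of _ "\<lambda>j. K - j" "\<lambda>k. K - k"]) auto
  ultimately show ?thesis by (simp add: sum.distrib add.commute)
qed

lemma sum_mult_rre_coeffs:
  "(\<Sum>k\<le>2 * K. r k * rre_coeffs K y k) = r K + (\<Sum>j\<in>{1..K}. y j * (r (K + j) + r (K - j) - 2 * r K))"
proof -
  have "(\<Sum>k\<le>2 * K. r k * rre_coeffs K y k) =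
      r K * (1 - 2 * (\<Sum>j\<in>{1..K}. y j)) + (\<Sum>j\<in>{1..K}. y j * (r (K + j) + r (K - j)))"
    unfolding sum_symmetric_about
    by (intro arg_cong2[of _ _ _ _ "(+)"] sum.cong) (auto simp: rre_coeffs_def algebra_simps)
  then show ?thesis
    by (simp add: right_diff_distrib sum_subtractf sum_distrib_left mult_ac)
qed

lemma rre_coeffs_feasible: "rre_coeffs K y \<in> rre_feasible K"
proof -
  have "(\<Sum>k\<le>2 * K. rre_coeffs K y k) = 1"
    using sum_mult_rre_coeffs[of "\<lambda>_. 1"] by simp
  then show ?thesis by (auto simp: rre_feasible_def rre_coeffs_def)
qed

lemma rre_feasible_eq_rre_coeffs:
  assumes "c \<in> rre_feasible K" "k \<le> 2 * K"
  shows "c k = rre_coeffs K (\<lambda>j. c (K + j)) k"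
proof -
  have sym: "c (K - j) = c (K + j)" if "j \<in> {1..K}" for j
    using assms(1) that by (auto simp: rre_feasible_def)
  have "1 = (\<Sum>k\<le>2 * K. c k)" using assms(1) by (simp add: rre_feasible_def)
  also have "\<dots> = c K + (\<Sum>j\<in>{1..K}. c (K + j) + c (K - j))" by (rule sum_symmetric_about)
  also have "(\<Sum>j\<in>{1..K}. c (K + j) + c (K - j)) = 2 * (\<Sum>j\<in>{1..K}. c (K + j))"
    unfolding sum_distrib_left by (rule sum.cong) (simp_all add: sym)
  finally show ?thesis using sym[of "K - k"] by (auto simp: rre_coeffs_def)
qed

lemma rre_minimum_attained:
  obtains c where "c \<in> rre_feasible K"
    "\<And>c'. c' \<in> rre_feasible K \<Longrightarrow> rre_objective w F h x\<^sub>0 K T \<epsilon> c \<le> rre_objective w F h x\<^sub>0 K T \<epsilon> c'"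
proof -
  let ?M = "rre_matrix w F h x\<^sub>0 K T \<epsilon>" and ?R = "({..<T} \<times> UNIV) <+> {..2 * K}"
  have objective: "rre_objective w F h x\<^sub>0 K T \<epsilon> (rre_coeffs K y) =
      (\<Sum>r\<in>?R. (?M r K + (\<Sum>j\<in>{1..K}. y j * (?M r (K + j) + ?M r (K - j) - 2 * ?M r K)))\<^sup>2)" for y
    unfolding rre_objective_def sum_mult_rre_coeffs ..
  obtain y where y_min: "\<And>y'. rre_objective w F h x\<^sub>0 K T \<epsilon> (rre_coeffs K y)
      \<le> rre_objective w F h x\<^sub>0 K T \<epsilon> (rre_coeffs K y')"
    using least_squares_attained[where R = ?R and J = "{1..K}" and b = "\<lambda>r. ?M r K"
        and A = "\<lambda>j r. ?M r (K + j) + ?M r (K - j) - 2 * ?M r K"]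
    unfolding objective by auto
  have "rre_objective w F h x\<^sub>0 K T \<epsilon> c' = rre_objective w F h x\<^sub>0 K T \<epsilon> (rre_coeffs K (\<lambda>j. c' (K + j)))"
    if "c' \<in> rre_feasible K" for c'
    unfolding rre_objective_def using rre_feasible_eq_rre_coeffs[OF that]
    by (intro sum.cong arg_cong[of _ _ "\<lambda>x. x\<^sup>2"]) auto
  then show thesis using that[OF rre_coeffs_feasible[of K y]] y_min by simp
qed

lemma rre_residual_sq_attained:
  obtains c where "c \<in> rre_feasible K" "rre_residual_sq w F h x\<^sub>0 K T \<epsilon> = rre_objective w F h x\<^sub>0 K T \<epsilon> c"
    and "\<And>c'. c' \<in> rre_feasible K \<Longrightarrow> rre_residual_sq w F h x\<^sub>0 K T \<epsilon> \<le> rre_objective w F h x\<^sub>0 K T \<epsilon> c'"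
proof -
  obtain c where c_min: "c \<in> rre_feasible K"
    "\<And>c'. c' \<in> rre_feasible K \<Longrightarrow> rre_objective w F h x\<^sub>0 K T \<epsilon> c \<le> rre_objective w F h x\<^sub>0 K T \<epsilon> c'"
    by (rule rre_minimum_attained[where K = K and w = w and F = F and h = h and x\<^sub>0 = x\<^sub>0 and T = T
          and \<epsilon> = \<epsilon>]) blast
  have "rre_residual_sq w F h x\<^sub>0 K T \<epsilon> = rre_objective w F h x\<^sub>0 K T \<epsilon> c"
    unfolding rre_residual_sq_def by (rule Least_equality) (use c_min in auto)
  with c_min that show thesis by simp
qed

definition symmetrize :: "(real \<Rightarrow> real) \<Rightarrow> real \<Rightarrow> real" where
  "symmetrize w x = (w x + w (1 - x)) / 2"

lemma smooth_bump_symmetrize: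
  assumes bump: "smooth_bump w"
  shows "smooth_bump (symmetrize w)"
proof -
  have "Cn_on n UNIV (symmetrize w)" for n
  proof -
    have "Cn_on n UNIV (\<lambda>x :: real. 1 - x)"
    proof (cases n)
      case (Suc n')
      show ?thesis unfolding Suc
        by (rule Cn_on_SucI[where f' = "\<lambda>_ v. - v"]) (auto intro!: derivative_eq_intros Cn_on_const)
    qed (auto intro!: continuous_intros)
    then have "Cn_on n UNIV (\<lambda>x. w (1 - x))"
      by (intro Cn_on_compose[OF _ _ smooth_bump_Cn_on[OF bump]]) auto
    then have "Cn_on n UNIV (\<lambda>x. w x + w (1 - x))"
      by (intro Cn_on_add open_UNIV smooth_bump_Cn_on[OF bump])
    then show ?thesis
      unfolding symmetrize_def[abs_def]
      by (rule Cn_on_bounded_linear[OF open_UNIV bounded_linear_divide])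
  qed
  then show ?thesis
    using bump by (auto simp: smooth_bump_def Ck_on_def symmetrize_def intro!: add_pos_pos)
qed

lemma bump_weight_symmetrize:
  assumes "k < N"
  shows "bump_weight (symmetrize w) N k = (bump_weight w N k + bump_weight w N (N - 1 - k)) / 2"
proof -
  have reflect: "1 - real (j + 1) / real (N + 1) = real (N - Suc j + 1) / real (N + 1)" if "j < N" for j
    using that by (simp add: field_simps)
  have "(\<Sum>j<N. w (1 - real (j + 1) / real (N + 1))) = (\<Sum>j<N. w (real (N - Suc j + 1) / real (N + 1)))"
    by (rule sum.cong) (simp_all only: reflect lessThan_iff)
  also have "\<dots> = bump_sum w N"
    unfolding bump_sum_def by (rule sum.nat_diff_reindex)
  finally have "bump_sum (symmetrize w) N = bump_sum w N"
    by (simp add: bump_sum_def symmetrize_def sum.distrib flip: sum_divide_distrib)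
  then show ?thesis
    unfolding bump_weight_eq symmetrize_def reflect[OF assms] by (simp add: add_divide_distrib)
qed

lemma rre_WK_eq_symmetrize: "k \<le> 2 * K \<Longrightarrow> rre_WK w K k k = bump_weight (symmetrize w) (2 * K + 1) k"
  by (subst bump_weight_symmetrize) (simp_all add: rre_WK_def)

lemma rre_data_row:
  fixes h :: "'x \<Rightarrow> real ^ 'D"
  assumes "t < T"
  shows "(\<Sum>k\<le>2 * K. rre_matrix w F h x\<^sub>0 K T \<epsilon> (Inl (t, i)) k * c k) =
    bump_weight w T t powr (1/2) * (\<Sum>k\<le>2 * K. c k *\<^sub>R rre_diff F h x\<^sub>0 (t + k)) $ i"
proof -
  have "rre_matrix w F h x\<^sub>0 K T \<epsilon> (Inl (t, i)) k =
      bump_weight w T t powr (1/2) * rre_diff F h x\<^sub>0 (t + k) $ i" for k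
  proof -
    have "rre_matrix w F h x\<^sub>0 K T \<epsilon> (Inl (t, i)) k = (\<Sum>j\<in>{..<T} \<times> UNIV. if (t, i) = j
        then bump_weight w T t powr (1/2) * rre_diff F h x\<^sub>0 (t + k) $ i else 0)"
      unfolding rre_matrix_def rmat_mult_def old.sum.case
      by (rule sum.cong) (auto simp: diag_powr_def rre_WT_def rre_U_def)
    also have "\<dots> = bump_weight w T t powr (1/2) * rre_diff F h x\<^sub>0 (t + k) $ i"
      using assms by (subst sum.delta') auto
    finally show ?thesis .
  qed
  then show ?thesis by (simp add: sum_distrib_left mult_ac)
qed

lemma rre_penalty_row:
  assumes "k \<le> 2 * K"
  shows "(\<Sum>l\<le>2 * K. rre_matrix w F h x\<^sub>0 K T \<epsilon> (Inr k) l * c l) =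
    \<epsilon> powr (1/2) * bump_weight (symmetrize w) (2 * K + 1) k powr (-1/2) * c k"
proof -
  have "(\<Sum>l\<le>2 * K. rre_matrix w F h x\<^sub>0 K T \<epsilon> (Inr k) l * c l) =
      (\<Sum>l\<le>2 * K. if k = l then \<epsilon> powr (1/2) * rre_WK w K k k powr (-1/2) * c k else 0)"
    by (rule sum.cong) (auto simp: rre_matrix_def diag_powr_def)
  then show ?thesis using assms by (simp add: rre_WK_eq_symmetrize)
qed

lemma rre_objective_eq:
  fixes h :: "'x \<Rightarrow> real ^ 'D"
  assumes bump: "smooth_bump w" and \<epsilon>_nonneg: "\<epsilon> \<ge> 0"
  shows "rre_objective w F h x\<^sub>0 K T \<epsilon> c =
    (\<Sum>t<T. bump_weight w T t * (norm (\<Sum>k\<le>2 * K. c k *\<^sub>R rre_diff F h x\<^sub>0 (t + k)))\<^sup>2)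
    + \<epsilon> * (\<Sum>k\<le>2 * K. (c k)\<^sup>2 / bump_weight (symmetrize w) (2 * K + 1) k)"
proof -
  let ?M = "rre_matrix w F h x\<^sub>0 K T \<epsilon>" and ?V = "bump_weight (symmetrize w) (2 * K + 1)"
  let ?d = "\<lambda>t. \<Sum>k\<le>2 * K. c k *\<^sub>R rre_diff F h x\<^sub>0 (t + k)"
  have data: "(\<Sum>k\<le>2 * K. ?M (Inl (t, i)) k * c k)\<^sup>2 = bump_weight w T t * (?d t $ i)\<^sup>2" if "t < T" for t i
    using bump_weight_pos[OF bump that]
    by (simp only: rre_data_row[OF that]) (simp add: power_mult_distrib powr_half_sqrt)
  have penalty: "(\<Sum>l\<le>2 * K. ?M (Inr k) l * c l)\<^sup>2 = \<epsilon> * ((c k)\<^sup>2 / ?V k)" if "k \<le> 2 * K" for k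
    using bump_weight_pos[OF smooth_bump_symmetrize[OF bump], of k "2 * K + 1"] that \<epsilon>_nonneg
    by (simp add: rre_penalty_row power_mult_distrib powr_half_sqrt powr_minus_divide power_divide)
  have "rre_objective w F h x\<^sub>0 K T \<epsilon> c
      = (\<Sum>(t, i)\<in>{..<T} \<times> UNIV. bump_weight w T t * (?d t $ i)\<^sup>2) + (\<Sum>k\<le>2 * K. \<epsilon> * ((c k)\<^sup>2 / ?V k))"
    unfolding rre_objective_def
    by (subst sum.Plus) (auto intro!: arg_cong2[of _ _ _ _ "(+)"] sum.cong simp: data penalty)
  also have "(\<Sum>(t, i)\<in>{..<T} \<times> UNIV. bump_weight w T t * (?d t $ i)\<^sup>2) =
      (\<Sum>t<T. bump_weight w T t * (norm (?d t))\<^sup>2)"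
  proof -
    have "(norm v)\<^sup>2 = (\<Sum>i\<in>UNIV. (v $ i)\<^sup>2)" for v :: "real ^ 'D"
      unfolding power2_norm_eq_inner inner_vec_def by (simp add: power2_eq_square)
    then show ?thesis by (simp only: sum_distrib_left sum.cartesian_product)
  qed
  finally show ?thesis by (simp add: sum_distrib_left)
qed

lemma rre_residual_ge:
  assumes bump: "smooth_bump w" and \<epsilon>_nonneg: "\<epsilon> \<ge> 0"
  shows "\<epsilon> \<le> rre_residual_sq w F h x\<^sub>0 K T \<epsilon>"
proof -
  let ?V = "bump_weight (symmetrize w) (2 * K + 1)"
  obtain c where c_min: "c \<in> rre_feasible K"
      "rre_residual_sq w F h x\<^sub>0 K T \<epsilon> = rre_objective w F h x\<^sub>0 K T \<epsilon> c"
    by (rule rre_residual_sq_attained)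
  have "(\<Sum>k\<le>2 * K. c k)\<^sup>2 \<le> (\<Sum>k\<le>2 * K. (c k)\<^sup>2 / ?V k) * (\<Sum>k\<le>2 * K. ?V k)"
    by (rule sum_squared_le_sum_divide_weights)
      (simp add: bump_weight_pos smooth_bump_symmetrize[OF bump])
  moreover have "(\<Sum>k\<le>2 * K. ?V k) = 1"
    by (rule sum_bump_weight_atMost[OF smooth_bump_symmetrize[OF bump]])
  ultimately have "\<epsilon> * 1 \<le> \<epsilon> * (\<Sum>k\<le>2 * K. (c k)\<^sup>2 / ?V k)"
    using c_min(1) \<epsilon>_nonneg by (intro mult_left_mono) (simp_all add: rre_feasible_def)
  moreover have "0 \<le> (\<Sum>t<T. bump_weight w T t * (norm (\<Sum>k\<le>2 * K. c k *\<^sub>R rre_diff F h x\<^sub>0 (t + k)))\<^sup>2)"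
    by (intro sum_nonneg mult_nonneg_nonneg) (auto intro: less_imp_le bump_weight_pos[OF bump])
  ultimately show ?thesis unfolding c_min(2) rre_objective_eq[OF bump \<epsilon>_nonneg] by simp
qed

lemma sum_bump_weight_rre_diff:
  "(\<Sum>k\<le>2 * K. bump_weight v (2 * K + 1) k *\<^sub>R rre_diff F h x\<^sub>0 (t + k)) =
    WB v F (2 * K + 1) h ((F ^^ (t + 1)) x\<^sub>0) - WB v F (2 * K + 1) h ((F ^^ t) x\<^sub>0)"
proof -
  have "(F ^^ k) ((F ^^ i) x\<^sub>0) = (F ^^ (i + k)) x\<^sub>0" for k i
    by (simp add: add.commute[of i] funpow_add)
  then show ?thesis
    by (simp add: WB_def rre_diff_def scaleR_diff_right sum_subtractf lessThan_Suc_atMost del: funpow.simps)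
qed

lemma rre_residual_le:
  assumes bump: "smooth_bump w" and \<epsilon>_nonneg: "\<epsilon> \<ge> 0" and T_ge: "T \<ge> 1"
    and oscillation_le: "\<And>t. norm (WB (symmetrize w) F (2 * K + 1) h ((F ^^ (t + 1)) x\<^sub>0)
      - WB (symmetrize w) F (2 * K + 1) h ((F ^^ t) x\<^sub>0)) \<le> d"
  shows "rre_residual_sq w F h x\<^sub>0 K T \<epsilon> \<le> \<epsilon> + d\<^sup>2"
proof -
  let ?V = "bump_weight (symmetrize w) (2 * K + 1)"
  have sum_V: "(\<Sum>k\<le>2 * K. ?V k) = 1"
    by (rule sum_bump_weight_atMost[OF smooth_bump_symmetrize[OF bump]])
  moreover have "?V (K + k) = ?V (K - k)" if "k \<in> {1..K}" for k
    using that by (subst (1 2) bump_weight_symmetrize) (auto simp: add.commute)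
  ultimately have "?V \<in> rre_feasible K" by (simp add: rre_feasible_def)
  then have "rre_residual_sq w F h x\<^sub>0 K T \<epsilon> \<le> rre_objective w F h x\<^sub>0 K T \<epsilon> ?V"
    by (metis rre_residual_sq_attained)
  also have "\<dots> \<le> d\<^sup>2 + \<epsilon>"
    unfolding rre_objective_eq[OF bump \<epsilon>_nonneg]
  proof (rule add_mono)
    have "(\<Sum>k\<le>2 * K. (?V k)\<^sup>2 / ?V k) = 1"
      unfolding sum_V[symmetric] by (rule sum.cong) (auto simp: power2_eq_square)
    then show "\<epsilon> * (\<Sum>k\<le>2 * K. (?V k)\<^sup>2 / ?V k) \<le> \<epsilon>" by simp
    have "(\<Sum>t<T. bump_weight w T t * (norm (\<Sum>k\<le>2 * K. ?V k *\<^sub>R rre_diff F h x\<^sub>0 (t + k)))\<^sup>2)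
        \<le> (\<Sum>t<T. bump_weight w T t * d\<^sup>2)"
      unfolding sum_bump_weight_rre_diff
      by (intro sum_mono mult_left_mono power_mono oscillation_le)
        (auto intro: less_imp_le bump_weight_pos[OF bump])
    also have "\<dots> = d\<^sup>2" using sum_bump_weight[OF bump T_ge] by (simp flip: sum_distrib_right)
    finally show "(\<Sum>t<T. bump_weight w T t * (norm (\<Sum>k\<le>2 * K. ?V k *\<^sub>R rre_diff F h x\<^sub>0 (t + k)))\<^sup>2)
        \<le> d\<^sup>2" .
  qed
  finally show ?thesis by simp
qed

lemma rre_residual_rate:
  assumes bump: "smooth_bump w" and \<epsilon>_nonneg: "\<epsilon> \<ge> 0" and T_ge: "T \<ge> 1" and K_ge: "K \<ge> 1"
    and orbit: "\<And>t. (F ^^ t) x\<^sub>0 \<in> X\<^sub>0"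
    and rate: "\<And>N x. N \<ge> 1 \<Longrightarrow> x \<in> X\<^sub>0 \<Longrightarrow> norm (WB (symmetrize w) F N h x - I) \<le> C / real N ^ m"
  shows "rre_residual_sq w F h x\<^sub>0 K T \<epsilon> \<le> \<epsilon> + (2 * C)\<^sup>2 / real (2 * K) ^ (2 * m)"
proof -
  let ?W = "\<lambda>t. WB (symmetrize w) F (2 * K + 1) h ((F ^^ t) x\<^sub>0)"
  have "0 \<le> C" using order_trans[OF norm_ge_zero rate[OF _ orbit[of 0], of 1]] by simp
  have "norm (?W t - I) \<le> C / real (2 * K) ^ m" for t
  proof -
    have "norm (?W t - I) \<le> C / real (2 * K + 1) ^ m" by (rule rate[OF _ orbit]) simp
    also have "\<dots> \<le> C / real (2 * K) ^ m"
      using \<open>0 \<le> C\<close> K_ge by (intro divide_left_mono power_mono mult_pos_pos zero_less_power) auto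
    finally show ?thesis .
  qed
  then have "norm (?W (t + 1) - ?W t) \<le> 2 * C / real (2 * K) ^ m" for t
    using norm_triangle_ineq4[of "?W (t + 1) - I" "?W t - I"]
    by (smt (verit) add_divide_distrib diff_diff_eq2 diff_add_cancel)
  then have "rre_residual_sq w F h x\<^sub>0 K T \<epsilon> \<le> \<epsilon> + (2 * C / real (2 * K) ^ m)\<^sup>2"
    by (rule rre_residual_le[OF bump \<epsilon>_nonneg T_ge])
  then show ?thesis by (simp only: power_divide power_mult[symmetric] mult.commute[of m])
qed

theorem mainTheorem1:
  fixes w :: "real \<Rightarrow> real"
    and M :: enat
    and X :: "'x topology"
    and A :: "('x, 'e::euclidean_space) chart set"
    and F :: "'x \<Rightarrow> 'x"
    and X\<^sub>0 :: "'x set"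
    and \<mu> :: "'x measure"
    and p m :: nat
    and z :: "nat \<Rightarrow> real ^ 'd \<Rightarrow> 'x"
    and \<omega> :: "real ^ 'd"
    and c \<nu> :: real
    and h :: "'x \<Rightarrow> real ^ 'D"
  assumes "1 \<le> M"
    and H1: "smooth_bump w"
    and H2: "diophantine c \<nu> \<omega>"
    and H3: "Ck_manifold M X A"
      "Ck_map M X A X A F"
      "island_dynamics M X A F X\<^sub>0 \<omega> \<mu> p z"
      "Ck_map M X A euclidean std_atlas h"
    and m: "1 < m"
      "ereal_of_enat M > ereal (real CARD('d) + real m * \<nu>)"
  shows "\<exists>C\<^sub>m.
    (\<forall>N\<ge>1. \<forall>x\<in>X\<^sub>0. norm (WB w F N h x - (LINT y:X\<^sub>0|\<mu>. h y)) \<le> C\<^sub>m / real N ^ m) \<and>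
    (\<forall>x\<^sub>0\<in>X\<^sub>0. \<forall>K\<ge>1. \<forall>T\<ge>1. \<forall>\<epsilon>\<ge>0.
       \<epsilon> \<le> rre_residual_sq w F h x\<^sub>0 K T \<epsilon> \<and>
       rre_residual_sq w F h x\<^sub>0 K T \<epsilon> \<le> \<epsilon> + C\<^sub>m / real (2 * K) ^ (2 * m))"
proof -
  let ?I = "LINT y:X\<^sub>0|\<mu>. h y"
  obtain C where rate: "\<And>N x. N \<ge> 1 \<Longrightarrow> x \<in> X\<^sub>0 \<Longrightarrow> norm (WB w F N h x - ?I) \<le> C / real N ^ m"
    using weighted_birkhoff_average[OF H1 H2 H3 m(2)] by blast
  obtain C' where rate_symmetrize:
      "\<And>N x. N \<ge> 1 \<Longrightarrow> x \<in> X\<^sub>0 \<Longrightarrow> norm (WB (symmetrize w) F N h x - ?I) \<le> C' / real N ^ m"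
    using weighted_birkhoff_average[OF smooth_bump_symmetrize[OF H1] H2 H3 m(2)] by blast
  define C\<^sub>m where "C\<^sub>m = max C ((2 * C')\<^sup>2)"
  have C\<^sub>m_ge: "C / a \<le> C\<^sub>m / a" "(2 * C')\<^sup>2 / a \<le> C\<^sub>m / a" if "a \<ge> 0" for a :: real
    using that by (auto simp: C\<^sub>m_def intro!: divide_right_mono)
  have "norm (WB w F N h x - ?I) \<le> C\<^sub>m / real N ^ m" if "N \<ge> 1" "x \<in> X\<^sub>0" for N x
    using rate[OF that] C\<^sub>m_ge(1)[of "real N ^ m"] by simp
  moreover have "\<epsilon> \<le> rre_residual_sq w F h x\<^sub>0 K T \<epsilon>" if "\<epsilon> \<ge> 0" for x\<^sub>0 K T \<epsilon>
    using rre_residual_ge[OF H1 that] .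
  moreover have "rre_residual_sq w F h x\<^sub>0 K T \<epsilon> \<le> \<epsilon> + C\<^sub>m / real (2 * K) ^ (2 * m)"
    if "x\<^sub>0 \<in> X\<^sub>0" "K \<ge> 1" "T \<ge> 1" "\<epsilon> \<ge> 0" for x\<^sub>0 K T \<epsilon>
    using rre_residual_rate[OF H1 that(4,3,2) island_forward_invariant[OF H3(3) that(1)] rate_symmetrize]
      C\<^sub>m_ge(2)[of "real (2 * K) ^ (2 * m)"] by simp
  ultimately show ?thesis by blast
qed

end
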